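(* Let $k\geq 1$ be an integer. Assume that $x,y$ are two complex numbers such that $\mathrm{Re}(x)>|\mathrm{Re}(y)|$ and that $\rho$ is a complex number satisfying $-\frac{k}{4}<\mathrm{Re}(\rho)<\frac{k}{4}$. Then the following summation formula holds: $$(2\pi y)^{\frac{k}{4}}+\sum_{n=1}^{\infty}\frac{r_{k}(n)}{n^{\frac{k}{4}}}\,e^{-\pi nx}\,M_{\rho,\frac{k}{4}-\frac{1}{2}}\left(2\pi ny\right)=\left(\frac{2\pi y}{x^{2}-y^{2}}\right)^{\frac{k}{4}}\left(\frac{x-y}{x+y}\right)^{\rho}+\left(\frac{x-y}{x+y}\right)^{\rho}\sum_{n=1}^{\infty}\frac{r_{k}(n)}{n^{\frac{k}{4}}}\,e^{-\frac{\pi nx}{x^{2}-y^{2}}}\,M_{-\rho,\frac{k}{4}-\frac{1}{2}}\left(\frac{2\pi ny}{x^{2}-y^{2}}\right).$$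
   Context: For a positive integer $k$, $r_k(n)$ denotes the number of representations of the positive integer $n$ as a sum of $k$ squares, i.e. the number of $(m_1,\dots,m_k)\in\mathbb{Z}^k$ with $m_1^2+\cdots+m_k^2=n$ (so order and signs count; for instance $r_1(n)=2$ if $n$ is a perfect square and $0$ otherwise). The Kummer confluent hypergeometric function is ${}_1F_1(a;c;z)=\sum_{j=0}^{\infty}\frac{(a)_j}{(c)_j}\frac{z^j}{j!}$, where $(a)_j=\Gamma(a+j)/\Gamma(a)=a(a+1)\cdots(a+j-1)$ is the Pochhammer symbol. The Whittaker function of the first kind is $$M_{\mu,\nu}(z)=z^{\nu+\frac12}e^{-z/2}\,{}_1F_1\left(\nu-\mu+\tfrac12;\,2\nu+1;\,z\right).$$ Branches: $y^{\alpha}$, $(x^2-y^2)^{\alpha}$ and $\left(\frac{x-y}{x+y}\right)^{\rho}$ are principal powers (since $\mathrm{Re}(x\pm y)>0$, neither $x^2-y^2$ nor $\frac{x-y}{x+y}$ lies on $(-\infty,0]$). For $c>0$, the power $\left(\frac{cy}{x^2-y^2}\right)^{\alpha}$, including the one occurring in the definition of $M_{-\rho,\frac k4-\frac12}\left(\frac{2\pi ny}{x^2-y^2}\right)$, is understood as $c^{\alpha}y^{\alpha}(x^2-y^2)^{-\alpha}$; similarly $(cy)^\alpha=c^\alpha y^\alpha$. *)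

theory Defs
  imports "HOL-Analysis.Analysis"
begin

definition num_sum_squares :: "nat \<Rightarrow> nat \<Rightarrow> nat" where
  "num_sum_squares k n =
     card {m \<in> {..<k} \<rightarrow>\<^sub>E (UNIV :: int set). (\<Sum>i<k. (m i)\<^sup>2) = int n}"

definition kummer_1F1 :: "complex \<Rightarrow> complex \<Rightarrow> complex \<Rightarrow> complex" where
  "kummer_1F1 a c z = (\<Sum>j. pochhammer a j / pochhammer c j * z ^ j / fact j)"

text \<open>
  The Whittaker function of the first kind is multivalued through its factor
  \<open>z powr (\<nu> + 1/2)\<close>. The first argument \<open>p\<close> is the chosen value of that power.
\<close>
definition whittaker_M_branch :: "complex \<Rightarrow> complex \<Rightarrow> complex \<Rightarrow> complex \<Rightarrow> complex" where
  "whittaker_M_branch p \<mu> \<nu> z = p * exp (- z / 2) * kummer_1F1 (\<nu> - \<mu> + 1/2) (2 * \<nu> + 1) z"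

definition whittaker_M :: "complex \<Rightarrow> complex \<Rightarrow> complex \<Rightarrow> complex" where
  "whittaker_M \<mu> \<nu> z = whittaker_M_branch (z powr (\<nu> + 1/2)) \<mu> \<nu> z"

text \<open>
  The branch of \<open>(c y / d)\<^sup>\<alpha>\<close> given by multiplying the principal powers of \<open>c\<close>, \<open>y\<close> and
  \<open>1 / d\<close>; in general it differs from the principal power of the quotient.
\<close>
definition quot_powr :: "real \<Rightarrow> complex \<Rightarrow> complex \<Rightarrow> complex \<Rightarrow> complex" where
  "quot_powr c y d \<alpha> = of_real c powr \<alpha> * y powr \<alpha> * d powr (- \<alpha>)"

definition whittaker_M_quot ::
    "complex \<Rightarrow> complex \<Rightarrow> real \<Rightarrow> complex \<Rightarrow> complex \<Rightarrow> complex" where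
  "whittaker_M_quot \<mu> \<nu> c y d =
     whittaker_M_branch (quot_powr c y d (\<nu> + 1/2)) \<mu> \<nu> (of_real c * y / d)"

end

theory Submission
  imports Defs "HOL-Probability.Characteristic_Functions" "HOL-Complex_Analysis.Conformal_Mappings"
begin

text \<open>
  Put \<open>A = x + y\<close>, \<open>B = x - y\<close>, \<open>a = k/4 - \<rho>\<close> and \<open>b = k/4 + \<rho>\<close>, so that \<open>A\<close>, \<open>B\<close>, \<open>a\<close> and \<open>b\<close>
  all have positive real part and \<open>a + b = k/2\<close>. Write \<open>E\<^bsub>a,b\<^esub> F\<close> (\<open>beta_mean a b F\<close> below) for the
  normalised integral of \<open>F(t) t\<^bsup>a-1\<^esup> (1-t)\<^bsup>b-1\<^esup>\<close> over \<open>[0,1]\<close>. Euler's integral says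
  \<open>\<^sub>1F\<^sub>1(a; a+b; w) = E\<^bsub>a,b\<^esub> exp(w t)\<close> (\<open>kummer_1F1_eq_beta_mean\<close>). Hence, up to the common factor
  \<open>(2\<pi>y)\<^bsup>k/4\<^esup>\<close>, the left-hand side is \<open>E\<^bsub>a,b\<^esub>\<close> of \<open>\<Sum>\<^sub>n r\<^sub>k(n) exp(-\<pi> n z(t)) = \<theta>(z(t))\<^bsup>k\<^esup>\<close>, where
  \<open>z(t) = (1-t) A + t B\<close> runs through the segment from \<open>A\<close> to \<open>B\<close> in the right half-plane. In the
  same way the right-hand side is a multiple of \<open>E\<^bsub>b,a\<^esub>\<close> of \<open>\<theta>\<^bsup>k\<^esup>\<close> along the segment from \<open>1/B\<close> to
  \<open>1/A\<close>. The inversion formula \<open>\<theta>(1/z) = z\<^bsup>1/2\<^esup> \<theta>(z)\<close> turns the first mean into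
  \<open>E\<^bsub>a,b\<^esub> [z\<^bsup>-k/2\<^esup> \<theta>(1/z)\<^bsup>k\<^esup>]\<close>, and the two sides are matched term by term by
  \<open>E\<^bsub>a,b\<^esub> [z\<^bsup>-(a+b)\<^esup> exp(w/z)] = A\<^bsup>-b\<^esup> B\<^bsup>-a\<^esup> E\<^bsub>b,a\<^esub> [exp(w ((1-s)/B + s/A))]\<close>
  (\<open>beta_mean_linepath_powr_exp\<close>).

  For real \<open>A\<close>, \<open>B\<close> the last identity is the substitution \<open>s = (1-t) A / z(t)\<close>. For complex \<open>A\<close>, \<open>B\<close> this
  would move the path of integration, so it is obtained from power series instead. Only the moments of
  the beta weight enter: the exponential series reduces the identity to Feynman's formula
  \<open>E\<^bsub>a,b\<^esub> z\<^bsup>-(a+b)\<^esup> = A\<^bsup>-b\<^esup> B\<^bsup>-a\<^esup>\<close> (\<open>beta_mean_linepath_powr\<close>). A disc \<open>|z - R| < R\<close> with \<open>R\<close> large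
  contains the whole segment, the binomial series converges uniformly there, and integrating it term by
  term gives the Cauchy product of the binomial series of \<open>A\<^bsup>-b\<^esup>\<close> and \<open>B\<^bsup>-a\<^esup>\<close>.

  The theta inversion is proved first for real \<open>z = s > 0\<close>. The periodisation of the Gaussian
  \<open>exp(-\<pi> s t\<^sup>2)\<close> and its expected Fourier series are continuous functions on \<open>[0,1]\<close> with the same
  cosine coefficients, hence equal by Weierstrass approximation in \<open>cos(2\<pi>t)\<close>
  (\<open>cos_moments_zero_imp_zero\<close>); the value at \<open>t = 0\<close> is the inversion formula. The identity theorem
  extends it to the half-plane.
\<close>

section \<open>Sums of squares as coefficients of powers of the theta series\<close>

definition square_roots :: "nat \<Rightarrow> int set" where
  "square_roots n = {j. j\<^sup>2 = int n}"

lemma square_roots_square: "square_roots (m\<^sup>2) = {int m, - int m}"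
  by (auto simp: square_roots_def power2_eq_iff)

text \<open>
  Together with the previous lemma this makes the coefficients of the theta series explicit:
  1 at 0, 2 at positive squares, 0 elsewhere.
\<close>
lemma square_roots_eq_empty:
  assumes "n \<notin> range (\<lambda>m. m\<^sup>2)"
  shows "square_roots n = {}"
proof -
  have False if "j\<^sup>2 = int n" for j
  proof -
    have "int ((nat \<bar>j\<bar>)\<^sup>2) = int n" using that by simp
    then show False using assms by (metis of_nat_eq_iff rangeI)
  qed
  then show ?thesis by (auto simp: square_roots_def)
qed

lemma card_square_roots_le: "finite (square_roots n) \<and> card (square_roots n) \<le> 2"
proof (cases "n \<in> range (\<lambda>m. m\<^sup>2)")
  case True
  then obtain m where "n = m\<^sup>2" by auto
  then show ?thesis by (simp add: square_roots_square card_insert_if)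
qed (simp add: square_roots_eq_empty)

definition square_sum_tuples :: "nat \<Rightarrow> nat \<Rightarrow> (nat \<Rightarrow> int) set" where
  "square_sum_tuples k n = {m \<in> {..<k} \<rightarrow>\<^sub>E UNIV. (\<Sum>i<k. (m i)\<^sup>2) = int n}"

text \<open>
  Every entry satisfies \<open>|m\<^sub>i| \<le> m\<^sub>i\<^sup>2 \<le> n\<close>.
\<close>
lemma finite_square_sum_tuples: "finite (square_sum_tuples k n)"
proof (rule finite_subset)
  show "square_sum_tuples k n \<subseteq> {..<k} \<rightarrow>\<^sub>E {- int n..int n}"
  proof
    fix m assume m: "m \<in> square_sum_tuples k n"
    have "m i \<in> {- int n..int n}" if "i < k" for i
    proof -
      have "\<bar>m i\<bar> \<le> (m i)\<^sup>2" 
        using mult_left_mono[of 1 "\<bar>m i\<bar>" "\<bar>m i\<bar>"]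
        by (cases "m i = 0") (auto simp: power2_eq_square simp flip: abs_mult)
      also have "\<dots> \<le> (\<Sum>i<k. (m i)\<^sup>2)" using that by (intro member_le_sum) auto
      also have "\<dots> = int n" using m by (simp add: square_sum_tuples_def)
      finally show ?thesis by (simp add: abs_le_iff)
    qed
    then show "m \<in> {..<k} \<rightarrow>\<^sub>E {- int n..int n}"
      using m by (auto simp: square_sum_tuples_def PiE_iff)
  qed
qed (auto intro!: finite_PiE)

text \<open>
  Sorting the representations by the square of the last entry gives the Cauchy product that
  defines multiplication by the theta series.
\<close>
lemma num_sum_squares_Suc:
  "num_sum_squares (Suc k) n = (\<Sum>i\<le>n. card (square_roots i) * num_sum_squares k (n - i))"
proof -
  let ?f = "\<lambda>(y :: int, g). g(k := y)"
  let ?D = "\<lambda>i. square_roots i \<times> square_sum_tuples k (n - i)"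
  have split: "(\<Sum>i<Suc k. ((g(k := y)) i)\<^sup>2) = (\<Sum>i<k. (g i)\<^sup>2) + y\<^sup>2" for g and y :: int
    by simp
  have "square_sum_tuples (Suc k) n = ?f ` (\<Union>i\<le>n. ?D i)"
  proof (intro equalityI subsetI)
    fix m assume m: "m \<in> square_sum_tuples (Suc k) n"
    then have "m \<in> ?f ` (UNIV \<times> ({..<k} \<rightarrow>\<^sub>E UNIV))"
      using PiE_insert_eq[of k "{..<k}" "\<lambda>_. UNIV :: int set"]
      by (simp add: square_sum_tuples_def lessThan_Suc)
    then obtain y g where yg: "m = g(k := y)" "g \<in> {..<k} \<rightarrow>\<^sub>E UNIV" by auto
    have s: "(\<Sum>i<k. (g i)\<^sup>2) + y\<^sup>2 = int n"
      using m split[of g y] unfolding square_sum_tuples_def yg(1) by simp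
    have nn: "(\<Sum>i<k. (g i)\<^sup>2) \<ge> 0" by (simp add: sum_nonneg)
    define i where "i = nat (y\<^sup>2)"
    have "int i = y\<^sup>2" by (simp add: i_def)
    with s nn have "i \<le> n" "y \<in> square_roots i" "(\<Sum>i<k. (g i)\<^sup>2) = int (n - i)"
      by (auto simp: square_roots_def)
    with yg show "m \<in> ?f ` (\<Union>i\<le>n. ?D i)"
      by (force simp: square_sum_tuples_def)
  next
    fix m assume "m \<in> ?f ` (\<Union>i\<le>n. ?D i)"
    then obtain i y g where *: "m = g(k := y)" "i \<le> n" "y\<^sup>2 = int i" "g \<in> {..<k} \<rightarrow>\<^sub>E UNIV"
        "(\<Sum>i<k. (g i)\<^sup>2) = int (n - i)"
      by (auto simp: square_roots_def square_sum_tuples_def)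
    then show "m \<in> square_sum_tuples (Suc k) n"
      using split[of g y] by (auto simp: square_sum_tuples_def PiE_iff extensional_def)
  qed
  moreover have "inj_on ?f (\<Union>i\<le>n. ?D i)"
    using inj_combinator[of k "{..<k}" "\<lambda>_. UNIV :: int set"]
    by (rule inj_on_subset) (auto simp: square_sum_tuples_def)
  ultimately have "card (square_sum_tuples (Suc k) n) = card (\<Union>i\<le>n. ?D i)"
    by (simp add: card_image)
  also have "\<dots> = (\<Sum>i\<le>n. card (?D i))"
    by (rule card_UN_disjoint)
       (use finite_square_sum_tuples card_square_roots_le in \<open>auto simp: square_roots_def\<close>)
  finally show ?thesis
    by (simp add: num_sum_squares_def square_sum_tuples_def card_cartesian_product)
qed

text \<open>
  The theta series \<open>\<Sum>\<^bsub>j\<in>\<int>\<^esub> q\<^bsup>j\<^sup>2\<^esup>\<close> as a formal power series in \<open>q\<close>. This makes the theory of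
  convergence radii and products of power series applicable to its powers.
\<close>
definition theta_fps :: "complex fps" where
  "theta_fps = Abs_fps (\<lambda>n. of_nat (card (square_roots n)))"

lemma fps_nth_theta_power: "fps_nth (theta_fps ^ k) n = of_nat (num_sum_squares k n)"
proof (induction k arbitrary: n)
  case 0
  show ?case by (auto simp: num_sum_squares_def)
next
  case (Suc k)
  then show ?case
    by (simp add: fps_mult_nth num_sum_squares_Suc theta_fps_def atLeast0AtMost)
qed

lemma fps_conv_radius_theta: "fps_conv_radius theta_fps \<ge> 1"
  unfolding fps_conv_radius_def
proof (rule conv_radius_geI_ex')
  fix r :: real assume r: "0 < r" "ereal r < 1"
  show "summable (\<lambda>n. fps_nth theta_fps n * of_real r ^ n)"
  proof (rule summable_comparison_test)
    show "summable (\<lambda>n. 2 * r ^ n)" using r by (intro summable_mult summable_geometric) auto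
    show "\<exists>N. \<forall>n\<ge>N. norm (fps_nth theta_fps n * of_real r ^ n) \<le> 2 * r ^ n"
      using r card_square_roots_le by (auto simp: theta_fps_def norm_mult norm_power intro!: mult_right_mono)
  qed
qed

text \<open>
  Jacobi's \<open>\<Sum>\<^bsub>j\<in>\<int>\<^esub> exp(-\<pi> j\<^sup>2 z)\<close>, meaningful for \<open>Re z > 0\<close>.
\<close>
definition theta :: "complex \<Rightarrow> complex" where
  "theta z = eval_fps theta_fps (exp (- of_real pi * z))"

lemma norm_nome_less_conv_radius:
  assumes "Re z > 0"
  shows "ereal (norm (exp (- of_real pi * z))) < fps_conv_radius theta_fps"
proof -
  have "norm (exp (- of_real pi * z)) < 1" using assms by simp
  then show ?thesis using fps_conv_radius_theta by (metis ereal_less(3) less_le_trans)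
qed

text \<open>
  Only square exponents contribute, so the power series in \<open>q\<close> may be summed over the subsequence of
  squares; \<open>j\<close> and \<open>-j\<close> are collected in one term.
\<close>
lemma theta_sums:
  assumes "Re z > 0"
  shows "(\<lambda>m. (if m = 0 then 1 else 2) * exp (- of_real pi * z) ^ (m\<^sup>2)) sums theta z"
proof -
  let ?q = "exp (- of_real pi * z)"
  note conv = norm_nome_less_conv_radius[OF assms]
  have "(\<lambda>n. fps_nth theta_fps n * ?q ^ n) sums theta z"
    unfolding theta_def by (rule sums_eval_fps[OF conv])
  moreover have "strict_mono (\<lambda>m::nat. m\<^sup>2)"
    by (intro strict_monoI power_strict_mono) auto
  ultimately have "(\<lambda>m. fps_nth theta_fps (m\<^sup>2) * ?q ^ (m\<^sup>2)) sums theta z"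
    by (subst sums_mono_reindex) (auto simp: theta_fps_def square_roots_eq_empty)
  moreover have "fps_nth theta_fps (m\<^sup>2) = (if m = 0 then 1 else 2)" for m
    by (simp add: theta_fps_def square_roots_square)
  ultimately show ?thesis by simp
qed

lemma theta_power_sums:
  assumes "Re z > 0"
  shows "(\<lambda>n. of_nat (num_sum_squares k n) * exp (- of_real pi * of_nat n * z)) sums theta z ^ k"
    and "summable (\<lambda>n. norm (of_nat (num_sum_squares k n) * exp (- of_real pi * of_nat n * z)))"
proof -
  let ?q = "exp (- of_real pi * z)"
  note conv = norm_nome_less_conv_radius[OF assms]
  then have conv': "ereal (norm ?q) < fps_conv_radius (theta_fps ^ k)"
    using fps_conv_radius_power by (metis less_le_trans)
  have q: "?q ^ n = exp (- of_real pi * of_nat n * z)" for n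
    by (simp add: mult_ac flip: exp_of_nat_mult)
  show "(\<lambda>n. of_nat (num_sum_squares k n) * exp (- of_real pi * of_nat n * z)) sums theta z ^ k"
    using sums_eval_fps[OF conv'] by (simp only: fps_nth_theta_power q theta_def eval_fps_power[OF conv])
  show "summable (\<lambda>n. norm (of_nat (num_sum_squares k n) * exp (- of_real pi * of_nat n * z)))"
    using abs_summable_in_conv_radius[of ?q "fps_nth (theta_fps ^ k)"] conv'
    by (simp only: fps_nth_theta_power q fps_conv_radius_def)
qed

lemma theta_holomorphic: "theta holomorphic_on {z. Re z > 0}"
proof -
  have "(\<lambda>z. exp (- of_real pi * z)) ` {z. Re z > 0} \<subseteq> eball 0 (fps_conv_radius theta_fps)"
    using norm_nome_less_conv_radius by (auto simp: in_eball_iff)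
  then have "eval_fps theta_fps \<circ> (\<lambda>z. exp (- of_real pi * z)) holomorphic_on {z. Re z > 0}"
    by (intro holomorphic_on_compose holomorphic_on_eval_fps holomorphic_intros)
  then show ?thesis
    by (simp add: theta_def[abs_def] o_def)
qed

section \<open>Theta inversion on the positive real axis\<close>

text \<open>
  The characteristic function of the standard normal distribution, rescaled by the factor
  \<open>sqrt (2 * pi * s)\<close>.
\<close>
lemma gaussian_cos_integral:
  fixes s :: real and m :: nat
  assumes s: "s > 0"
  defines "F \<equiv> (\<lambda>x. exp (- pi * s * x\<^sup>2) * cos (2 * pi * real m * x))"
  shows "integrable lborel F" and "(LINT x|lborel. F x) = exp (- pi * (real m)\<^sup>2 / s) / sqrt s"
proof -
  define c where "c = sqrt (2 * pi * s)"
  define t where "t = 2 * pi * real m / c"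
  have c: "c > 0" "c\<^sup>2 = 2 * pi * s" using s by (auto simp: c_def)
  have "integrable std_normal_distribution (\<lambda>x. iexp (t * x))"
    using prob_space.integrable_iexp[OF real_distribution.axioms(1)[OF real_dist_normal_dist]] by simp
  then have "integrable std_normal_distribution (\<lambda>x. Re (iexp (t * x)))"
    and "(LINT x|std_normal_distribution. Re (iexp (t * x))) = Re (char std_normal_distribution t)"
    unfolding char_def by (auto intro: integral_Re[symmetric])
  then have i: "integrable std_normal_distribution (\<lambda>x. cos (t * x))"
    and v: "(LINT x|std_normal_distribution. cos (t * x)) = exp (- (t\<^sup>2) / 2)"
    unfolding char_std_normal_distribution by (simp_all add: Re_exp)
  have i2: "integrable lborel (\<lambda>x. std_normal_density x * cos (t * x))"
    using i by (subst (asm) integrable_density) auto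
  have v2: "(LINT x|lborel. std_normal_density x * cos (t * x)) = exp (- (t\<^sup>2) / 2)"
    using v by (subst (asm) integral_density) auto
  have F: "std_normal_density (0 + c * x) * cos (t * (0 + c * x)) = F x / sqrt (2 * pi)" for x
    using c by (simp add: std_normal_density_def F_def t_def power_mult_distrib mult.assoc)
  have "integrable lborel (\<lambda>x. std_normal_density (0 + c * x) * cos (t * (0 + c * x)))"
    using lborel_integrable_real_affine[OF i2, of c 0] c by simp
  then have "integrable lborel (\<lambda>x. sqrt (2 * pi) * (F x / sqrt (2 * pi)))"
    unfolding F by (rule integrable_mult_right)
  then show "integrable lborel F" by simp
  have "exp (- (t\<^sup>2) / 2) = c * (LINT x|lborel. F x / sqrt (2 * pi))"
    using lborel_integral_real_affine[of c "\<lambda>x. std_normal_density x * cos (t * x)" 0] c v2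
    unfolding F by simp
  also have "\<dots> = sqrt s * (LINT x|lborel. F x)"
    using s by (simp add: c_def real_sqrt_mult)
  finally have "(LINT x|lborel. F x) = exp (- (t\<^sup>2) / 2) / sqrt s" using s by (simp add: field_simps)
  moreover have "t\<^sup>2 / 2 = pi * (real m)\<^sup>2 / s"
    using s c(1) unfolding t_def power_divide c(2) by (simp add: field_simps power2_eq_square)
  ultimately show "(LINT x|lborel. F x) = exp (- pi * (real m)\<^sup>2 / s) / sqrt s" by simp
qed

lemma integral_sums_uniform:
  fixes F :: "nat \<Rightarrow> real \<Rightarrow> real"
  assumes F: "\<And>n. continuous_on {a..b} (F n)"
    and M: "\<And>n t. t \<in> {a..b} \<Longrightarrow> norm (F n t) \<le> M n" "summable M"
    and f: "\<And>t. t \<in> {a..b} \<Longrightarrow> (\<lambda>n. F n t) sums f t"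
  shows "(\<lambda>n. integral {a..b} (F n)) sums integral {a..b} f"
proof -
  have "uniform_limit {a..b} (\<lambda>n t. \<Sum>i<n. F i t) (\<lambda>t. \<Sum>i. F i t) sequentially"
    by (rule Weierstrass_m_test[OF M])
  moreover have "continuous_on {a..b} (\<lambda>t. \<Sum>i<n. F i t)" for n
    by (intro continuous_on_sum F)
  ultimately obtain I J where I: "\<And>n. ((\<lambda>t. \<Sum>i<n. F i t) has_integral I n) {a..b}"
      and J: "((\<lambda>t. \<Sum>i. F i t) has_integral J) {a..b}" "I \<longlonglongrightarrow> J"
    by (rule uniform_limit_integral) auto
  have "I n = (\<Sum>i<n. integral {a..b} (F i))" for n
    using integral_unique[OF I[of n]] F
    by (subst (asm) integral_sum) (auto intro: integrable_continuous_interval)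
  moreover have "J = integral {a..b} f"
    using integral_unique[OF J(1)] f by (metis (no_types, lifting) integral_cong sums_unique)
  ultimately show ?thesis using J(2) unfolding sums_def by presburger
qed

text \<open>
  Pairing the translates by \<open>n\<close> and \<open>-n-1\<close> turns a bilateral periodisation into an ordinary series
  whose partial sums unfold to integrals over symmetric intervals.
\<close>
lemma symmetric_unfold_integral:
  fixes F :: "real \<Rightarrow> real"
  assumes "continuous_on UNIV F"
  shows "(\<Sum>n<N. integral {0..1} (\<lambda>t. F (t + real n) + F (t - real (Suc n)))) = integral {- real N..real N} F"
proof (induction N)
  case (Suc N)
  have c: "continuous_on S F" for S using assms continuous_on_subset by blast
  have i: "F integrable_on {u..v}" for u v by (intro integrable_continuous_interval c)
  have ci: "continuous_on {0..1} (\<lambda>t. F (t + d))" for d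
    by (intro continuous_on_compose2[OF assms] continuous_intros) auto
  have "integral {0..1} (\<lambda>t. F (t + real N) + F (t - real (Suc N)))
     = integral {0..1} (\<lambda>t. F (t + real N)) + integral {0..1} (\<lambda>t. F (t + - real (Suc N)))"
    using integral_add[OF integrable_continuous_interval[OF ci] integrable_continuous_interval[OF ci], of "real N" "- real (Suc N)"]
    by (simp only: diff_conv_add_uminus)
  also have "integral {0..1} (\<lambda>t. F (t + real N)) = integral {real N..real (Suc N)} F"
    using integral_shift_real_ivl[of "real N" "real N" "real (Suc N)" F] by simp
  also have "integral {0..1} (\<lambda>t. F (t + - real (Suc N))) = integral {- real (Suc N)..- real N} F"
    using integral_shift_real_ivl[of "- real (Suc N)" "- real (Suc N)" "- real N" F] by simp
  finally have *: "integral {0..1} (\<lambda>t. F (t + real N) + F (t - real (Suc N)))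
     = integral {real N..real (Suc N)} F + integral {- real (Suc N)..- real N} F" .
  have "integral {- real (Suc N)..real (Suc N)} F = integral {- real (Suc N)..- real N} F
     + integral {- real N..real N} F + integral {real N..real (Suc N)} F"
    using Henstock_Kurzweil_Integration.integral_combine[OF _ _ i, of "- real (Suc N)" "- real N" "real (Suc N)"]
      Henstock_Kurzweil_Integration.integral_combine[OF _ _ i, of "- real N" "real N" "real (Suc N)"] by simp
  with * Suc show ?case by simp
qed simp

lemma integral_symmetric_limit:
  fixes F :: "real \<Rightarrow> real"
  assumes F: "integrable lborel F"
  shows "(\<lambda>N. integral {- real N..real N} F) \<longlonglongrightarrow> (LINT x|lborel. F x)"
proof -
  have "(\<lambda>N. LINT x|lborel. indicator {- real N..real N} x *\<^sub>R F x) \<longlonglongrightarrow> (LINT x|lborel. F x)"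
  proof (rule integral_dominated_convergence)
    show "integrable lborel (\<lambda>x. norm (F x))" using F by simp
    show "F \<in> borel_measurable lborel" using F by simp
    then show "(\<lambda>x. indicator {- real N..real N} x *\<^sub>R F x) \<in> borel_measurable lborel" for N
      by measurable
    have "eventually (\<lambda>N. indicator {- real N..real N} x *\<^sub>R F x = F x) sequentially" for x
      using eventually_ge_at_top[of "nat \<lceil>\<bar>x\<bar>\<rceil>"]
      by eventually_elim (auto simp: indicator_def nat_le_iff ceiling_le_iff abs_le_iff)
    then show "AE x in lborel. (\<lambda>N. indicator {- real N..real N} x *\<^sub>R F x) \<longlonglongrightarrow> F x"
      by (intro AE_I2 tendsto_eventually) auto
  qed (auto simp: indicator_def)
  moreover have "(LINT x|lborel. indicator {- real N..real N} x *\<^sub>R F x) = integral {- real N..real N} F" for N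
  proof -
    have "set_integrable lborel {- real N..real N} F"
      unfolding set_integrable_def using F by (intro integrable_mult_indicator) auto
    from set_borel_integral_eq_integral(2)[OF this] show ?thesis
      by (simp add: set_lebesgue_integral_def)
  qed
  ultimately show ?thesis by simp
qed

text \<open>
  A function symmetric about \<open>1/2\<close> is a continuous function \<open>P\<close> of \<open>cos(2\<pi>t)\<close>. Polynomials in
  \<open>cos(2\<pi>t)\<close> are combinations of the functions \<open>cos(2\<pi>mt)\<close>, so \<open>h\<close> is orthogonal to all of them; by
  Weierstrass approximation of \<open>P\<close> it is then orthogonal to itself.
\<close>
lemma cos_moments_zero_imp_zero:
  fixes h :: "real \<Rightarrow> real"
  assumes h: "continuous_on {0..1} h" and sym: "\<And>t. t \<in> {0..1} \<Longrightarrow> h (1 - t) = h t"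
    and zero: "\<And>m::nat. integral {0..1} (\<lambda>t. h t * cos (2 * pi * real m * t)) = 0"
    and t: "t \<in> {0..1}"
  shows "h t = 0"
proof -
  let ?c = "\<lambda>t. cos (2 * pi * t)"
  have int: "(\<lambda>t. h t * g t) integrable_on {0..1}" if "continuous_on {0..1} g" for g
    using that by (intro integrable_continuous_interval continuous_intros h)
  have pow: "integral {0..1} (\<lambda>t. h t * (cos (2 * pi * real m * t) * ?c t ^ k)) = 0" for m k
  proof (induction k arbitrary: m)
    case (Suc k)
    show ?case
    proof (cases m)
      case 0
      then show ?thesis using Suc.IH[of 1] by simp
    next
      case (Suc l)
      have "cos (2 * pi * real m * t) * ?c t = (cos (2 * pi * real (Suc m) * t) + cos (2 * pi * real l * t)) / 2" for t
        by (simp add: cos_times_cos Suc algebra_simps)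
      then have "h t * ((cos (2 * pi * real m * t) * ?c t) * ?c t ^ k)
         = 1/2 * (h t * (cos (2 * pi * real (Suc m) * t) * ?c t ^ k)) + 1/2 * (h t * (cos (2 * pi * real l * t) * ?c t ^ k))" for t
        by (simp only:) (simp only: add_divide_distrib distrib_left distrib_right times_divide_eq_left times_divide_eq_right mult_1)
      then have "h t * (cos (2 * pi * real m * t) * ?c t ^ Suc k)
         = 1/2 * (h t * (cos (2 * pi * real (Suc m) * t) * ?c t ^ k)) + 1/2 * (h t * (cos (2 * pi * real l * t) * ?c t ^ k))" for t
        by (simp only: power_Suc mult.assoc)
      then have "integral {0..1} (\<lambda>t. h t * (cos (2 * pi * real m * t) * ?c t ^ Suc k))
         = 1/2 * integral {0..1} (\<lambda>t. h t * (cos (2 * pi * real (Suc m) * t) * ?c t ^ k))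
          + 1/2 * integral {0..1} (\<lambda>t. h t * (cos (2 * pi * real l * t) * ?c t ^ k))"
        by (simp only: integral_add integral_mult_right integrable_on_mult_right int continuous_intros)
      then show ?thesis using Suc.IH[of "Suc m"] Suc.IH[of l] by simp
    qed
  qed (simp add: zero)
  have poly: "integral {0..1} (\<lambda>t. h t * p (?c t)) = 0" if rp: "real_polynomial_function p" for p
  proof -
    obtain c n where p: "p = (\<lambda>x. \<Sum>i\<le>n. c i * x ^ i)"
      using rp real_polynomial_function_iff_sum by blast
    have "integral {0..1} (\<lambda>t. h t * p (?c t)) = integral {0..1} (\<lambda>t. \<Sum>i\<le>n. c i * (h t * ?c t ^ i))"
      by (simp add: p sum_distrib_left mult_ac)
    also have "\<dots> = (\<Sum>i\<le>n. c i * integral {0..1} (\<lambda>t. h t * ?c t ^ i))"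
      by (subst integral_sum) (auto intro!: integrable_on_mult_right int continuous_intros)
    finally show ?thesis using pow[of 0] by simp
  qed
  \<comment> \<open>For \<open>t \<le> 1/2\<close> the inverse of \<open>t \<mapsto> cos(2\<pi>t)\<close>; the symmetry of \<open>h\<close> covers \<open>t > 1/2\<close>.\<close>
  define P where "P u = h (arccos u / (2 * pi))" for u
  have cP: "continuous_on {-1..1} P"
    unfolding P_def
  proof (rule continuous_on_compose2[OF h])
    show "continuous_on {-1..1} (\<lambda>u. arccos u / (2 * pi))"
      by (intro continuous_intros) auto
    show "(\<lambda>u. arccos u / (2 * pi)) ` {-1..1} \<subseteq> {0..1}"
      using arccos_bounded by (fastforce simp: field_simps)
  qed
  have hP: "h t = P (?c t)" if t: "t \<in> {0..1}" for t
  proof (cases "t \<le> 1/2")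
    case True
    then have "arccos (?c t) = 2 * pi * t" using t by (intro arccos_cos) auto
    then show ?thesis by (simp add: P_def)
  next
    case False
    have "?c t = ?c (1 - t)"
      using cos_periodic[of "- (2 * pi * t)"] by (simp add: algebra_simps)
    moreover have "arccos (?c (1 - t)) = 2 * pi * (1 - t)" using t False by (intro arccos_cos) (auto simp: mult_le_cancel_left1)
    ultimately show ?thesis using sym[OF t] by (simp add: P_def)
  qed
  obtain B where B: "\<And>t. t \<in> {0..1} \<Longrightarrow> \<bar>h t\<bar> \<le> B"
    using compact_imp_bounded[OF compact_continuous_image[OF h]] unfolding bounded_iff
    by (metis compact_Icc imageI real_norm_def)
  have Bnn: "B \<ge> 0" using B[of 0] by simp
  have "integral {0..1} (\<lambda>t. h t * h t) \<le> e" if e: "e > 0" for e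
  proof -
    \<comment> \<open>An approximation up to \<open>e / (B + 1)\<close> makes the product with \<open>h\<close> smaller than \<open>e\<close>.\<close>
    have "e / (B + 1) > 0" using e Bnn by simp
    then obtain p where p: "real_polynomial_function p" "\<And>u. u \<in> {-1..1} \<Longrightarrow> \<bar>P u - p u\<bar> < e / (B + 1)"
      using Stone_Weierstrass_real_polynomial_function[OF _ cP] by (metis compact_Icc)
    have cp: "continuous_on {0..1} (\<lambda>t. p (?c t))"
      by (intro continuous_on_compose2[OF continuous_on_polymonial_function[of p UNIV]] continuous_intros)
         (use p(1) in \<open>auto simp: real_polynomial_function_eq\<close>)
    have "h t * (h t - p (?c t)) \<le> e" if t: "t \<in> {0..1}" for t
    proof -
      have "\<bar>h t * (h t - p (?c t))\<bar> \<le> B * (e / (B + 1))"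
        unfolding abs_mult using B[OF t] p(2)[of "?c t"] hP[OF t] by (intro mult_mono) auto
      also have "\<dots> \<le> e" using Bnn e by (simp add: field_simps)
      finally show ?thesis by simp
    qed
    then have "integral {0..1} (\<lambda>t. h t * (h t - p (?c t))) \<le> integral {0..1} (\<lambda>t::real. e)"
      by (intro integral_le int continuous_intros h cp) auto
    moreover have "integral {0..1} (\<lambda>t. h t * (h t - p (?c t))) = integral {0..1} (\<lambda>t. h t * h t) - integral {0..1} (\<lambda>t. h t * p (?c t))"
      unfolding right_diff_distrib by (intro integral_diff int h cp)
    ultimately show ?thesis using poly[OF p(1)] by simp
  qed
  then have "integral {0..1} (\<lambda>t. h t * h t) \<le> 0" by (meson dense_ge)
  moreover have "integral {0..1} (\<lambda>t. h t * h t) \<ge> 0" by (intro integral_nonneg int h) auto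
  ultimately have "integral {0..1} (\<lambda>t. h t * h t) = 0" by simp
  moreover have "continuous_on {0..1} (\<lambda>t. h t * h t)" by (intro continuous_intros h)
  ultimately have "\<forall>t\<in>{0..1}. h t * h t = 0"
    using integral_eq_0_iff[of 0 1 "\<lambda>t. h t * h t"] by simp
  then show ?thesis using t by simp
qed


definition gaussian :: "real \<Rightarrow> real \<Rightarrow> real" where
  "gaussian s x = exp (- pi * s * x\<^sup>2)"

lemma summable_gaussian_power:
  assumes "s > 0"
  shows "summable (\<lambda>n. exp (- pi * s) ^ n)"
  using assms by (intro summable_geometric) simp

text \<open>
  The geometric majorant is what makes all Gaussian series below converge uniformly.
\<close>
lemma gaussian_nat_le:
  assumes "s > 0" "real n \<le> \<bar>x\<bar>"
  shows "gaussian s x \<le> exp (- pi * s) ^ n"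
proof -
  have "real n \<le> (real n)\<^sup>2" by (cases n) (auto simp: power2_eq_square)
  also have "\<dots> \<le> x\<^sup>2" using assms(2) abs_le_square_iff[of "real n" x] by simp
  finally have "pi * s * real n \<le> pi * s * x\<^sup>2" using assms(1) by (intro mult_left_mono) auto
  then show ?thesis by (simp add: gaussian_def mult_ac flip: exp_of_nat_mult)
qed

lemma integral_cos_int:
  fixes j :: int
  shows "integral {0..1} (\<lambda>t. cos (2 * pi * of_int j * t)) = (if j = 0 then 1 else 0)"
proof (cases "j = 0")
  case False
  have "((\<lambda>t. cos (2 * pi * of_int j * t)) has_integral
      (sin (2 * pi * of_int j * 1) / (2 * pi * of_int j) - sin (2 * pi * of_int j * 0) / (2 * pi * of_int j))) {0..1}"
  proof (rule fundamental_theorem_of_calculus)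
    show "((\<lambda>t. sin (2 * pi * of_int j * t) / (2 * pi * of_int j)) has_vector_derivative cos (2 * pi * of_int j * t)) (at t within {0..1})"
      for t
      unfolding has_real_derivative_iff_has_vector_derivative[symmetric]
      using False by (auto intro!: derivative_eq_intros)
  qed simp
  moreover have "sin (2 * pi * of_int j) = 0"
    using sin_int_2pin by (simp add: mult_ac)
  ultimately show ?thesis using False by (simp add: integral_unique)
qed simp

lemma integral_cos_cos:
  fixes n m :: nat
  shows "integral {0..1} (\<lambda>t. cos (2 * pi * real n * t) * cos (2 * pi * real m * t))
     = (if n = m then if n = 0 then 1 else 1/2 else 0)"
proof -
  have *: "cos (2 * pi * real n * t) * cos (2 * pi * real m * t)
     = 1/2 * cos (2 * pi * of_int (int n - int m) * t) + 1/2 * cos (2 * pi * of_int (int n + int m) * t)" for t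
    by (subst cos_times_cos) (simp add: left_diff_distrib right_diff_distrib distrib_left distrib_right add_divide_distrib)
  have i: "(\<lambda>t. 1/2 * cos (2 * pi * of_int j * t)) integrable_on {0..1}" for j :: int
    by (intro integrable_continuous_interval continuous_intros)
  have "integral {0..1} (\<lambda>t. cos (2 * pi * real n * t) * cos (2 * pi * real m * t))
     = 1/2 * integral {0..1} (\<lambda>t. cos (2 * pi * of_int (int n - int m) * t))
       + 1/2 * integral {0..1} (\<lambda>t. cos (2 * pi * of_int (int n + int m) * t))"
    unfolding * by (subst integral_add[OF i i]) simp
  then show ?thesis unfolding integral_cos_int by auto
qed

text \<open>
  Here \<open>f\<close> is the periodised Gaussian, \<open>\<Sum>\<^bsub>j\<in>\<int>\<^esub> exp(-\<pi> s (t+j)\<^sup>2)\<close>, and \<open>g\<close> its prospective cosine series.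
  Both have the \<open>m\<close>-th cosine coefficient \<open>exp(-\<pi>m\<^sup>2/s) / sqrt s\<close>, for \<open>f\<close> by unfolding and for \<open>g\<close> by
  orthogonality, so \<open>f(0) = g(0)\<close>.
\<close>
lemma real_theta_inversion:
  assumes s: "s > 0"
  shows "\<exists>S. (\<lambda>n. (if n = 0 then 1 else 2) * gaussian s (real n)) sums S \<and>
             (\<lambda>n. (if n = 0 then 1 else 2) * gaussian (1 / s) (real n)) sums (sqrt s * S)"
proof -
  let ?\<epsilon> = "\<lambda>n::nat. if n = 0 then 1 else 2 :: real"
  define u where "u n t = gaussian s (t + real n) + gaussian s (t - real (Suc n))" for n t
  define v where "v n t = ?\<epsilon> n * gaussian (1 / s) (real n) / sqrt s * cos (2 * pi * real n * t)" for n t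
  define f where "f t = (\<Sum>n. u n t)" for t
  define g where "g t = (\<Sum>n. v n t)" for t
  define M where "M n = 2 * exp (- pi * s) ^ n" for n
  define L where "L n = 2 / sqrt s * exp (- pi * (1 / s)) ^ n" for n
  have cu: "continuous_on S (u n)" for S n unfolding u_def gaussian_def by (intro continuous_intros)
  have cv: "continuous_on S (v n)" for S n unfolding v_def by (intro continuous_intros) (use s in auto)
  have uM: "norm (u n t) \<le> M n" if t: "t \<in> {0..1}" for n t
  proof -
    have "gaussian s (t + real n) \<le> exp (- pi * s) ^ n" "gaussian s (t - real (Suc n)) \<le> exp (- pi * s) ^ n"
      using t by (intro gaussian_nat_le s; simp)+
    moreover have "gaussian s (t + real n) \<ge> 0" "gaussian s (t - real (Suc n)) \<ge> 0" by (simp_all add: gaussian_def)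
    ultimately show ?thesis unfolding u_def M_def by simp
  qed
  have vL: "norm (v n t) \<le> L n" for n t
  proof -
    have "norm (v n t) = ?\<epsilon> n / sqrt s * gaussian (1 / s) (real n) * \<bar>cos (2 * pi * real n * t)\<bar>"
      using s by (simp add: v_def abs_mult gaussian_def)
    also have "\<dots> \<le> 2 / sqrt s * exp (- pi * (1 / s)) ^ n * 1"
      using s by (intro mult_mono gaussian_nat_le mult_nonneg_nonneg) (auto simp: gaussian_def divide_right_mono)
    finally show ?thesis by (simp add: L_def)
  qed
  have sM: "summable M" unfolding M_def by (intro summable_mult summable_gaussian_power s)
  have sL: "summable L" unfolding L_def by (intro summable_mult summable_gaussian_power) (use s in auto)
  have fs: "(\<lambda>n. u n t) sums f t" if "t \<in> {0..1}" for t
    unfolding f_def by (intro summable_sums summable_comparison_test[OF _ sM]) (use uM[OF that] in auto)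
  have gs: "(\<lambda>n. v n t) sums g t" for t
    unfolding g_def by (intro summable_sums summable_comparison_test[OF _ sL]) (use vL in auto)
  have cf: "continuous_on {0..1} f"
    unfolding f_def by (rule uniform_limit_theorem[OF _ Weierstrass_m_test[OF uM sM]])
      (auto intro!: always_eventually continuous_on_sum cu)
  have cg: "continuous_on {0..1} g"
    unfolding g_def by (rule uniform_limit_theorem[OF _ Weierstrass_m_test[OF vL sL]])
      (auto intro!: always_eventually continuous_on_sum cv)
  have fhat: "integral {0..1} (\<lambda>t. f t * cos (2 * pi * real m * t)) = exp (- pi * (real m)\<^sup>2 / s) / sqrt s" for m
  proof -
    define F where "F x = gaussian s x * cos (2 * pi * real m * x)" for x
    have F: "integrable lborel F" "(LINT x|lborel. F x) = exp (- pi * (real m)\<^sup>2 / s) / sqrt s"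
      unfolding F_def gaussian_def using gaussian_cos_integral[OF s, of m] by auto
    have cF: "continuous_on UNIV F" unfolding F_def gaussian_def by (intro continuous_intros)
    have per: "cos (2 * pi * real m * (t + of_int d)) = cos (2 * pi * real m * t)" for t and d :: int
    proof -
      have "2 * pi * real m * (t + of_int d) = 2 * pi * real m * t + 2 * pi * of_int (int m * d)"
        by (simp add: algebra_simps)
      then show ?thesis using sin_int_2pin[of "int m * d"] cos_int_2pin[of "int m * d"] by (simp add: cos_add)
    qed
    have uF: "u n t * cos (2 * pi * real m * t) = F (t + real n) + F (t - real (Suc n))" for n t
      using per[of t "int n"] per[of t "- int (Suc n)"] by (simp add: u_def F_def algebra_simps)
    have "(\<lambda>n. integral {0..1} (\<lambda>t. u n t * cos (2 * pi * real m * t)))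
        sums integral {0..1} (\<lambda>t. f t * cos (2 * pi * real m * t))"
    proof (rule integral_sums_uniform[OF _ _ sM])
      show "norm (u n t * cos (2 * pi * real m * t)) \<le> M n" if "t \<in> {0..1}" for n t
        using mult_mono[OF uM[OF that] abs_cos_le_one[of "2 * pi * real m * t"]] order_trans[OF norm_ge_zero uM[OF that]]
        by (simp add: abs_mult)
    qed (auto intro!: continuous_intros cu sums_mult2 fs)
    then have "(\<lambda>N. integral {- real N..real N} F) \<longlonglongrightarrow> integral {0..1} (\<lambda>t. f t * cos (2 * pi * real m * t))"
      unfolding sums_def uF symmetric_unfold_integral[OF cF] .
    from LIMSEQ_unique[OF this integral_symmetric_limit[OF F(1)]] show ?thesis unfolding F(2) .
  qed
  have ghat: "integral {0..1} (\<lambda>t. g t * cos (2 * pi * real m * t)) = exp (- pi * (real m)\<^sup>2 / s) / sqrt s" for m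
  proof -
    have "(\<lambda>n. integral {0..1} (\<lambda>t. v n t * cos (2 * pi * real m * t)))
        sums integral {0..1} (\<lambda>t. g t * cos (2 * pi * real m * t))"
    proof (rule integral_sums_uniform[OF _ _ sL])
      show "norm (v n t * cos (2 * pi * real m * t)) \<le> L n" for n t
        using mult_mono[OF vL[of n t] abs_cos_le_one[of "2 * pi * real m * t"]] order_trans[OF norm_ge_zero vL[of n t]]
        by (simp add: abs_mult)
    qed (auto intro!: continuous_intros cv sums_mult2 gs)
    moreover have "integral {0..1} (\<lambda>t. v n t * cos (2 * pi * real m * t))
        = (if n = m then exp (- pi * (real m)\<^sup>2 / s) / sqrt s else 0)" for n
      using integral_cos_cos[of n m] by (simp add: v_def mult.assoc gaussian_def)
    ultimately have "(\<lambda>n. if n = m then exp (- pi * (real m)\<^sup>2 / s) / sqrt s else 0)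
        sums integral {0..1} (\<lambda>t. g t * cos (2 * pi * real m * t))" by simp
    then show ?thesis
      using sums_single[of m "\<lambda>_. exp (- pi * (real m)\<^sup>2 / s) / sqrt s"] sums_unique2 by blast
  qed
  have fsym: "f (1 - t) = f t" for t
  proof -
    have "u n (1 - t) = u n t" for n
      unfolding u_def gaussian_def by (simp add: power2_eq_square algebra_simps)
    then show ?thesis by (simp add: f_def)
  qed
  have gsym: "g (1 - t) = g t" for t
  proof -
    have "cos (2 * pi * real n * (1 - t)) = cos (2 * pi * real n * t)" for n
      using cos_int_2pin[of "int n"] sin_int_2pin[of "int n"] by (simp add: right_diff_distrib cos_diff)
    then show ?thesis by (simp add: g_def v_def)
  qed
  have "f 0 - g 0 = 0"
  proof (rule cos_moments_zero_imp_zero[where h = "\<lambda>t. f t - g t"])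
    show "integral {0..1} (\<lambda>t. (f t - g t) * cos (2 * pi * real m * t)) = 0" for m
    proof -
      have "integral {0..1} (\<lambda>t. (f t - g t) * cos (2 * pi * real m * t))
         = integral {0..1} (\<lambda>t. f t * cos (2 * pi * real m * t)) - integral {0..1} (\<lambda>t. g t * cos (2 * pi * real m * t))"
        unfolding left_diff_distrib
        by (intro integral_diff integrable_continuous_interval continuous_intros cf cg)
      then show ?thesis by (simp add: fhat ghat)
    qed
  qed (auto intro!: continuous_intros cf cg simp: fsym gsym)
  then have eq: "f 0 = g 0" by simp
  have "summable (\<lambda>n. gaussian s (real n))"
  proof (rule summable_comparison_test'[OF summable_gaussian_power[OF s]])
    show "norm (gaussian s (real n)) \<le> exp (- pi * s) ^ n" for n
      using gaussian_nat_le[OF s, of n "real n"] by (simp add: gaussian_def)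
  qed
  then obtain S0 where S0: "(\<lambda>n. gaussian s (real n)) sums S0" by (auto simp: summable_def)
  have g0: "gaussian s 0 = 1" by (simp add: gaussian_def)
  have S1: "(\<lambda>n. gaussian s (real (Suc n))) sums (S0 - 1)"
    using S0 g0 by (subst sums_Suc_iff) simp
  have "gaussian s (- x) = gaussian s x" for x by (simp add: gaussian_def)
  then have "u n 0 = gaussian s (real n) + gaussian s (real (Suc n))" for n
    unfolding u_def by (metis add_0 diff_0)
  then have "(\<lambda>n. u n 0) sums (S0 + (S0 - 1))" using sums_add[OF S0 S1] by simp
  then have f0: "f 0 = S0 + (S0 - 1)" using fs[of 0] sums_unique2 by fastforce
  have "(\<lambda>n. 2 * gaussian s (real (Suc n))) sums (f 0 - 1)"
    using sums_mult[OF S1, of 2] f0 by simp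
  then have "(\<lambda>n. ?\<epsilon> n * gaussian s (real n)) sums f 0"
    using sums_Suc_iff[of "\<lambda>n. ?\<epsilon> n * gaussian s (real n)" "f 0 - 1"] g0 by simp
  moreover have "(\<lambda>n. sqrt s * v n 0) sums (sqrt s * g 0)" by (intro sums_mult gs)
  then have "(\<lambda>n. ?\<epsilon> n * gaussian (1 / s) (real n)) sums (sqrt s * f 0)"
    using s eq by (simp add: v_def mult_ac)
  ultimately show ?thesis by blast
qed

section \<open>Integration against the complex beta weight\<close>

definition beta_weight :: "complex \<Rightarrow> complex \<Rightarrow> real \<Rightarrow> complex" where
  "beta_weight a b t = of_real t powr (a - 1) * of_real (1 - t) powr (b - 1)"

definition beta_integral :: "complex \<Rightarrow> complex \<Rightarrow> (real \<Rightarrow> complex) \<Rightarrow> complex" where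
  "beta_integral a b f = integral {0..1} (\<lambda>t. beta_weight a b t * f t)"

lemma norm_beta_weight:
  assumes "t \<in> {0..1}"
  shows "norm (beta_weight a b t) = t powr (Re a - 1) * (1 - t) powr (Re b - 1)"
proof -
  have "norm (complex_of_real (1 - t) powr (b - 1)) = (1 - t) powr (Re b - 1)"
    using assms by (subst norm_powr_real_powr) auto
  then show ?thesis
    using assms by (simp add: beta_weight_def norm_mult norm_powr_real_powr)
qed

lemma absolutely_integrable_beta_weight:
  assumes "Re a > 0" "Re b > 0"
  shows "beta_weight a b absolutely_integrable_on {0..1}"
proof (rule measurable_bounded_by_integrable_imp_absolutely_integrable)
  show "(\<lambda>t. t powr (Re a - 1) * (1 - t) powr (Re b - 1)) integrable_on {0..1}"
    using assms by (intro integrable_Beta') auto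
  have "beta_weight a b \<in> borel_measurable borel"
    unfolding beta_weight_def by measurable
  then show "beta_weight a b \<in> borel_measurable (lebesgue_on {0..1})"
    by (simp add: borel_measurable_if_D measurable_completion measurable_restrict_space1)
  show "norm (beta_weight a b t) \<le> t powr (Re a - 1) * (1 - t) powr (Re b - 1)"
    if "t \<in> {0..1}" for t
    using norm_beta_weight[OF that] by simp
qed auto

lemma integrable_beta_weight_mult:
  assumes "Re a > 0" "Re b > 0" "continuous_on {0..1} f"
  shows "(\<lambda>t. beta_weight a b t * f t) integrable_on {0..1}"
proof -
  have "(\<lambda>t. f t * beta_weight a b t) absolutely_integrable_on {0..1}"
  proof (rule absolutely_integrable_bounded_measurable_product[of "(*)"])
    show "bilinear ((*) :: complex \<Rightarrow> complex \<Rightarrow> complex)"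
      using bilinear_conv_bounded_bilinear bounded_bilinear_mult by blast
    show "f \<in> borel_measurable (lebesgue_on {0..1})"
      using assms(3) by (intro continuous_imp_measurable_on_sets_lebesgue) auto
    show "bounded (f ` {0..1})"
      using assms(3) by (intro compact_imp_bounded compact_continuous_image) auto
  qed (use assms absolutely_integrable_beta_weight in auto)
  then show ?thesis
    using set_lebesgue_integral_eq_integral(1) by (simp add: mult.commute)
qed

text \<open>
  Boundedness for the supremum norm is what allows uniformly convergent series to be integrated term by
  term although the weight is singular at the endpoints.
\<close>
lemma norm_beta_integral_le:
  assumes "Re a > 0" "Re b > 0" "continuous_on {0..1} f"
    and "\<And>t. t \<in> {0..1} \<Longrightarrow> norm (f t) \<le> B"
  shows "norm (beta_integral a b f) \<le> integral {0..1} (\<lambda>t. norm (beta_weight a b t)) * B"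
proof -
  have i: "(\<lambda>t. norm (beta_weight a b t)) integrable_on {0..1}"
    using absolutely_integrable_beta_weight[OF assms(1,2)] absolutely_integrable_on_def by blast
  have "norm (beta_integral a b f) \<le> integral {0..1} (\<lambda>t. norm (beta_weight a b t) * B)"
    unfolding beta_integral_def
    by (rule integral_norm_bound_integral[OF integrable_beta_weight_mult[OF assms(1-3)]])
       (use integrable_on_mult_left[OF i, of B] assms(4) in \<open>auto simp: norm_mult intro!: mult_left_mono\<close>)
  then show ?thesis by simp
qed

lemma beta_integral_diff:
  assumes "Re a > 0" "Re b > 0" "continuous_on {0..1} f" "continuous_on {0..1} g"
  shows "beta_integral a b (\<lambda>t. f t - g t) = beta_integral a b f - beta_integral a b g"
  unfolding beta_integral_def right_diff_distrib
  by (intro integral_diff integrable_beta_weight_mult assms)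

lemma beta_integral_add:
  assumes "Re a > 0" "Re b > 0" "continuous_on {0..1} f" "continuous_on {0..1} g"
  shows "beta_integral a b (\<lambda>t. f t + g t) = beta_integral a b f + beta_integral a b g"
  unfolding beta_integral_def distrib_left
  by (intro integral_add integrable_beta_weight_mult assms)

lemma beta_integral_cmult: "beta_integral a b (\<lambda>t. c * f t) = c * beta_integral a b f"
  unfolding beta_integral_def by (simp add: mult.left_commute[of _ c])

lemma beta_integral_cong:
  "(\<And>t. t \<in> {0..1} \<Longrightarrow> f t = g t) \<Longrightarrow> beta_integral a b f = beta_integral a b g"
  unfolding beta_integral_def by (rule integral_cong) simp

lemma beta_integral_sum:
  assumes "Re a > 0" "Re b > 0" "finite I" "\<And>i. i \<in> I \<Longrightarrow> continuous_on {0..1} (f i)"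
  shows "beta_integral a b (\<lambda>t. \<Sum>i\<in>I. f i t) = (\<Sum>i\<in>I. beta_integral a b (f i))"
  unfolding beta_integral_def sum_distrib_left
  by (intro integral_sum integrable_beta_weight_mult assms)

text \<open>
  The Weierstrass M-test, phrased for a pointwise sum.
\<close>
lemma continuous_on_sums:
  fixes F :: "nat \<Rightarrow> real \<Rightarrow> 'a :: banach"
  assumes "\<And>n. continuous_on S (F n)" "\<And>n t. t \<in> S \<Longrightarrow> norm (F n t) \<le> M n"
    and "summable M" "\<And>t. t \<in> S \<Longrightarrow> (\<lambda>n. F n t) sums f t"
  shows "continuous_on S f"
proof -
  have "uniform_limit S (\<lambda>n t. \<Sum>i<n. F i t) (\<lambda>t. \<Sum>i. F i t) sequentially"
    by (rule Weierstrass_m_test[OF assms(2,3)])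
  then have "continuous_on S (\<lambda>t. \<Sum>i. F i t)"
    by (rule uniform_limit_theorem[rotated]) (auto intro!: always_eventually continuous_on_sum assms)
  then show ?thesis
    by (rule continuous_on_eq) (use assms(4) sums_unique in fastforce)
qed

lemma beta_integral_sums:
  assumes ab: "Re a > 0" "Re b > 0"
    and F: "\<And>n. continuous_on {0..1} (F n)"
    and M: "\<And>n t. t \<in> {0..1} \<Longrightarrow> norm (F n t) \<le> M n" "summable M"
    and f: "\<And>t. t \<in> {0..1} \<Longrightarrow> (\<lambda>n. F n t) sums f t"
  shows "(\<lambda>n. beta_integral a b (F n)) sums beta_integral a b f"
proof -
  define K where "K = integral {0..1} (\<lambda>t. norm (beta_weight a b t))"
  have cf: "continuous_on {0..1} f"
    by (rule continuous_on_sums[OF F M f])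
  have bound: "norm ((\<Sum>i<n. beta_integral a b (F i)) - beta_integral a b f) \<le> K * (\<Sum>i. M (i + n))"
    for n
  proof -
    have "norm (f t - (\<Sum>i<n. F i t)) \<le> (\<Sum>i. M (i + n))" if t: "t \<in> {0..1}" for t
    proof -
      have s: "(\<lambda>i. F (i + n) t) sums (f t - (\<Sum>i<n. F i t))"
        using f[OF t] by (rule sums_split_initial_segment)
      have m: "summable (\<lambda>i. M (i + n))" using M(2) by (rule summable_ignore_initial_segment)
      have "norm (\<Sum>i. F (i + n) t) \<le> (\<Sum>i. M (i + n))"
        by (rule norm_suminf_le[OF _ m]) (use M(1)[OF t] in auto)
      then show ?thesis using s sums_unique by metis
    qed
    then have "norm (beta_integral a b (\<lambda>t. f t - (\<Sum>i<n. F i t))) \<le> K * (\<Sum>i. M (i + n))"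
      unfolding K_def
      by (intro norm_beta_integral_le ab continuous_on_diff continuous_on_sum cf F)
    moreover have "beta_integral a b (\<lambda>t. f t - (\<Sum>i<n. F i t))
        = beta_integral a b f - (\<Sum>i<n. beta_integral a b (F i))"
      by (subst beta_integral_diff[OF ab cf], (intro continuous_on_sum F)[1],
          subst beta_integral_sum[OF ab]) (use F in auto)
    ultimately show ?thesis by (simp add: norm_minus_commute)
  qed
  have "(\<lambda>n. K * (\<Sum>i. M (i + n))) \<longlonglongrightarrow> 0"
    using tendsto_mult_left[OF suminf_exist_split2[OF M(2)], of K] by simp
  then have "(\<lambda>n. (\<Sum>i<n. beta_integral a b (F i)) - beta_integral a b f) \<longlonglongrightarrow> 0"
    by (rule Lim_null_comparison[rotated]) (rule always_eventually, rule allI, rule bound)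
  then show ?thesis
    unfolding sums_def by (rule LIM_zero_cancel)
qed

abbreviation beta_moment where "beta_moment a b \<equiv> beta_integral a b (\<lambda>_. 1)"

lemma beta_weight_shift:
  assumes "t \<in> {0<..<1}"
  shows "beta_weight (a + of_nat p) (b + of_nat q) t = beta_weight a b t * (of_real t ^ p * of_real (1 - t) ^ q)"
proof -
  have "complex_of_real t powr (a + of_nat p - 1) = of_real t powr (a - 1) * of_real t ^ p"
    using assms powr_add[of "complex_of_real t" "a - 1" "of_nat p"] 
    by (simp add: powr_nat algebra_simps split: if_splits)
  moreover have "complex_of_real (1 - t) powr (b + of_nat q - 1) = of_real (1 - t) powr (b - 1) * of_real (1 - t) ^ q"
    using assms powr_add[of "complex_of_real (1 - t)" "b - 1" "of_nat q"] 
    by (simp add: powr_nat algebra_simps split: if_splits)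
  ultimately show ?thesis by (simp add: beta_weight_def)
qed

lemma beta_integral_shift:
  "beta_integral (a + of_nat p) (b + of_nat q) f
     = beta_integral a b (\<lambda>t. of_real t ^ p * of_real (1 - t) ^ q * f t)"
  unfolding beta_integral_def
  by (rule integral_spike[where S = "{0,1}"]) (auto simp: beta_weight_shift mult.assoc)

text \<open>
  Integration by parts: the derivative of \<open>t\<^bsup>a\<^esup> (1-t)\<^bsup>b\<^esup>\<close>, which vanishes at both endpoints.
\<close>
lemma beta_moment_parts:
  assumes "Re a > 0" "Re b > 0"
  shows "a * beta_moment a (b + 1) = b * beta_moment (a + 1) b"
proof -
  have cont: "continuous_on {0..1} (\<lambda>t. complex_of_real t powr a * of_real (1 - t) powr b)"
    by (intro continuous_intros) (use assms in auto)
  have "((\<lambda>t. a * beta_weight a (b + 1) t - b * beta_weight (a + 1) b t) has_integral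
        (complex_of_real 1 powr a * of_real (1 - 1) powr b - complex_of_real 0 powr a * of_real (1 - 0) powr b)) {0..1}"
  proof (rule fundamental_theorem_of_calculus_interior[OF _ cont])
    fix t :: real assume t: "t \<in> {0<..<1}"
    have 1: "((\<lambda>u. u powr a * (1 - u) powr b) has_field_derivative
       a * beta_weight a (b + 1) t - b * beta_weight (a + 1) b t) (at (of_real t))"
      unfolding beta_weight_def using t
      by (auto intro!: derivative_eq_intros simp: algebra_simps complex_nonpos_Reals_iff)
    show "((\<lambda>t. complex_of_real t powr a * of_real (1 - t) powr b) has_vector_derivative
       a * beta_weight a (b + 1) t - b * beta_weight (a + 1) b t) (at t)"
      using has_vector_derivative_real_field[OF 1] by simp
  qed auto
  moreover have "(0::complex) powr a = 0" "(0::complex) powr b = 0" by auto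
  ultimately have "integral {0..1} (\<lambda>t. a * beta_weight a (b + 1) t - b * beta_weight (a + 1) b t) = 0"
    by (simp add: integral_unique)
  moreover have "integral {0..1} (\<lambda>t. a * beta_weight a (b + 1) t - b * beta_weight (a + 1) b t)
     = a * beta_moment a (b + 1) - b * beta_moment (a + 1) b"
    unfolding beta_integral_def
    using integrable_beta_weight_mult[of a "b+1" "\<lambda>_. 1"] integrable_beta_weight_mult[of "a+1" b "\<lambda>_. 1"] assms
    by (subst integral_diff) (auto intro!: integrable_on_mult_right)
  ultimately show ?thesis by simp
qed

text \<open>
  Combine integration by parts with \<open>1 = t + (1 - t)\<close>.
\<close>
lemma beta_moment_Suc:
  assumes ab: "Re a > 0" "Re b > 0"
  shows "(a + b) * beta_moment (a + 1) b = a * beta_moment a b"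
    and "(a + b) * beta_moment a (b + 1) = b * beta_moment a b"
proof -
  have "beta_moment a b = beta_integral a b (\<lambda>t. of_real t + of_real (1 - t))"
    by simp
  also have "\<dots> = beta_moment (a + 1) b + beta_moment a (b + 1)"
    using beta_integral_shift[of a 1 b 0 "\<lambda>_. 1"] beta_integral_shift[of a 0 b 1 "\<lambda>_. 1"]
    by (subst beta_integral_add[OF ab]) (auto intro!: continuous_intros)
  finally have eq: "beta_moment a b = beta_moment (a + 1) b + beta_moment a (b + 1)" .
  then show "(a + b) * beta_moment (a + 1) b = a * beta_moment a b"
    and "(a + b) * beta_moment a (b + 1) = b * beta_moment a b"
    using beta_moment_parts[OF ab] by (auto simp: algebra_simps)
qed

lemma beta_moment_pochhammer:
  assumes "Re a > 0" "Re b > 0"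
  shows "pochhammer (a + b) (p + q) * beta_moment (a + of_nat p) (b + of_nat q)
           = pochhammer a p * pochhammer b q * beta_moment a b"
proof (induction q)
  case 0
  show ?case
  proof (induction p)
    case (Suc p)
    have "(a + of_nat p + b) * beta_moment (a + of_nat p + 1) b = (a + of_nat p) * beta_moment (a + of_nat p) b"
      using beta_moment_Suc(1)[of "a + of_nat p" b] assms by simp
    then have "pochhammer (a + b) p * ((a + of_nat p + b) * beta_moment (a + of_nat p + 1) b)
        = (a + of_nat p) * (pochhammer (a + b) p * beta_moment (a + of_nat p) b)"
      by simp
    with Suc show ?case
      by (simp add: pochhammer_Suc algebra_simps)
  qed auto
next
  case (Suc q)
  have "(a + of_nat p + (b + of_nat q)) * beta_moment (a + of_nat p) (b + of_nat q + 1)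
        = (b + of_nat q) * beta_moment (a + of_nat p) (b + of_nat q)"
    using beta_moment_Suc(2)[of "a + of_nat p" "b + of_nat q"] assms by simp
  then have "pochhammer (a + b) (p + q) * ((a + of_nat p + (b + of_nat q)) * beta_moment (a + of_nat p) (b + of_nat q + 1))
     = (b + of_nat q) * (pochhammer (a + b) (p + q) * beta_moment (a + of_nat p) (b + of_nat q))"
    by simp
  with Suc show ?case
    by (simp add: pochhammer_Suc algebra_simps)
qed

lemma pochhammer_nonzero:
  assumes "Re c > 0" shows "pochhammer (c::complex) n \<noteq> 0"
proof
  assume "pochhammer c n = 0"
  then obtain k where "c = - of_nat k" by (auto simp: pochhammer_eq_0_iff)
  with assms show False by simp
qed

text \<open>
  All moments are multiples of the zeroth one.
\<close>
lemma beta_integral_polynomial_eq_0: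
  assumes ab: "Re a > 0" "Re b > 0" and 0: "beta_moment a b = 0"
    and p: "real_polynomial_function (p :: real \<Rightarrow> real)"
  shows "beta_integral a b (\<lambda>t. of_real (p t)) = 0"
proof -
  have mono: "beta_integral a b (\<lambda>t. of_real t ^ i) = 0" for i
    using beta_moment_pochhammer[OF ab, of i 0] beta_integral_shift[of a i b 0 "\<lambda>_. 1"]
      pochhammer_nonzero[of "a + b" i] ab 0 by simp
  obtain c n where pc: "p = (\<lambda>x. \<Sum>i\<le>n. c i * x ^ i)"
    using p real_polynomial_function_iff_sum by blast
  have "beta_integral a b (\<lambda>t. of_real (p t)) = beta_integral a b (\<lambda>t. \<Sum>i\<le>n. of_real (c i) * of_real t ^ i)"
    by (simp add: pc)
  also have "\<dots> = (\<Sum>i\<le>n. of_real (c i) * beta_integral a b (\<lambda>t. of_real t ^ i))"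
    by (subst beta_integral_sum[OF ab]) (auto simp: beta_integral_cmult intro!: continuous_intros)
  finally show ?thesis by (simp add: mono)
qed

text \<open>
  If this moment vanished, the beta weight would annihilate all polynomials, hence by Weierstrass all
  continuous functions. Against \<open>t\<^bsup>cnj a\<^esup> (1-t)\<^bsup>cnj b\<^esup>\<close>, however, it integrates to a value of the real
  beta function at positive arguments.
\<close>
lemma beta_moment_nonzero:
  assumes ab: "Re a > 0" "Re b > 0"
  shows "beta_moment a b \<noteq> 0"
proof
  assume 0: "beta_moment a b = 0"
  define h where "h = (\<lambda>t. complex_of_real t powr cnj a * of_real (1 - t) powr cnj b)"
  define K where "K = integral {0..1} (\<lambda>t. norm (beta_weight a b t))"
  define J where "J = Beta (2 * Re a) (2 * Re b)"
  have Jpos: "J > 0" unfolding J_def Beta_def using ab by (auto intro!: divide_pos_pos mult_pos_pos Gamma_real_pos)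
  have Knn: "K \<ge> 0" unfolding K_def
    by (rule integral_nonneg)
       (use absolutely_integrable_beta_weight[OF ab] absolutely_integrable_on_def in blast, simp)
  have ch: "continuous_on {0..1} h"
    unfolding h_def by (intro continuous_intros) (use ab in auto)
  have pw: "complex_of_real u powr (c - 1) * of_real u powr cnj c = of_real (u powr (2 * Re c - 1))"
    if "u > 0" for u c
  proof -
    have "complex_of_real u powr (c - 1) * of_real u powr cnj c = of_real u powr (c - 1 + cnj c)"
      using that by (simp add: powr_add)
    also have "c - 1 + cnj c = of_real (2 * Re c - 1)" by (simp add: complex_eq_iff)
    finally show ?thesis using that by (simp add: powr_of_real del: of_real_diff of_real_mult)
  qed
  have "beta_integral a b h
      = integral {0..1} (\<lambda>t. complex_of_real (t powr (2 * Re a - 1) * (1 - t) powr (2 * Re b - 1)))"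
    unfolding beta_integral_def
  proof (rule integral_spike[where S = "{0,1}"])
    fix t :: real assume "t \<in> {0..1} - {0, 1}"
    then have "t > 0" "1 - t > 0" by auto
    moreover have "beta_weight a b t * h t
      = (of_real t powr (a - 1) * of_real t powr cnj a) * (of_real (1 - t) powr (b - 1) * of_real (1 - t) powr cnj b)"
      by (simp only: beta_weight_def h_def mult_ac)
    ultimately show "complex_of_real (t powr (2 * Re a - 1) * (1 - t) powr (2 * Re b - 1)) = beta_weight a b t * h t"
      by (simp only: pw of_real_mult)
  qed auto
  also have "\<dots> = of_real J"
    using has_integral_Beta_real[of "2 * Re a" "2 * Re b"] ab unfolding J_def
    by (intro integral_unique has_integral_of_real) auto
  finally have hJ: "beta_integral a b h = of_real J" .
  \<comment> \<open>Any \<open>e\<close> with \<open>0 < e\<close> and \<open>K * e < J\<close> would do; \<open>K + 1\<close> avoids dividing by zero.\<close>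
  define e where "e = J / (2 * (K + 1))"
  have e: "e > 0" using Jpos Knn by (simp add: e_def)
  obtain g where g: "polynomial_function g" "\<And>t. t \<in> {0..1} \<Longrightarrow> norm (h t - g t) < e"
    using Stone_Weierstrass_polynomial_function[OF _ ch e] by auto
  have cg: "continuous_on {0..1} g" using g(1) by (rule continuous_on_polymonial_function)
  have rp: "real_polynomial_function (\<lambda>t. Re (g t))" "real_polynomial_function (\<lambda>t. Im (g t))"
    using g(1) bounded_linear_Re bounded_linear_Im unfolding polynomial_function_def o_def by blast+
  have "beta_integral a b g = beta_integral a b (\<lambda>t. of_real (Re (g t)) + \<i> * of_real (Im (g t)))"
    by (rule beta_integral_cong) (simp add: complex_eq)
  also have "\<dots> = beta_integral a b (\<lambda>t. of_real (Re (g t))) + \<i> * beta_integral a b (\<lambda>t. of_real (Im (g t)))"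
    by (subst beta_integral_add[OF ab]) (auto intro!: continuous_intros cg simp: beta_integral_cmult)
  also have "\<dots> = 0"
    using beta_integral_polynomial_eq_0[OF ab 0] rp by simp
  finally have "beta_integral a b (\<lambda>t. h t - g t) = of_real J"
    using hJ beta_integral_diff[OF ab ch cg] by simp
  moreover have "norm (beta_integral a b (\<lambda>t. h t - g t)) \<le> K * e"
    unfolding K_def by (intro norm_beta_integral_le ab continuous_intros ch cg) (use g(2) less_imp_le in auto)
  ultimately have "J \<le> K * e" using Jpos by simp
  moreover have "K * e < J" using Jpos Knn by (simp add: e_def field_simps add_nonneg_pos)
  ultimately show False by simp
qed

section \<open>Beta means, the Kummer function and powers on a segment\<close>

definition beta_mean :: "complex \<Rightarrow> complex \<Rightarrow> (real \<Rightarrow> complex) \<Rightarrow> complex" where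
  "beta_mean a b f = beta_integral a b f / beta_moment a b"

lemma beta_mean_monomial:
  assumes "Re a > 0" "Re b > 0"
  shows "beta_mean a b (\<lambda>t. of_real t ^ p * of_real (1 - t) ^ q)
           = pochhammer a p * pochhammer b q / pochhammer (a + b) (p + q)"
  using beta_moment_pochhammer[OF assms, of p q] beta_integral_shift[of a p b q "\<lambda>_. 1"]
    beta_moment_nonzero[OF assms] pochhammer_nonzero[of "a + b" "p + q"] assms
  by (simp add: beta_mean_def field_simps)

lemma beta_mean_cmult: "beta_mean a b (\<lambda>t. c * f t) = c * beta_mean a b f"
  by (simp add: beta_mean_def beta_integral_cmult)

lemma beta_mean_sum:
  assumes "Re a > 0" "Re b > 0" "finite I" "\<And>i. i \<in> I \<Longrightarrow> continuous_on {0..1} (f i)"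
  shows "beta_mean a b (\<lambda>t. \<Sum>i\<in>I. f i t) = (\<Sum>i\<in>I. beta_mean a b (f i))"
  by (simp add: beta_mean_def beta_integral_sum assms sum_divide_distrib)

lemma beta_mean_cong:
  "(\<And>t. t \<in> {0..1} \<Longrightarrow> f t = g t) \<Longrightarrow> beta_mean a b f = beta_mean a b g"
  unfolding beta_mean_def using beta_integral_cong[of f g] by simp

lemma beta_mean_sums:
  assumes "Re a > 0" "Re b > 0"
    and "\<And>n. continuous_on {0..1} (F n)"
    and "\<And>n t. t \<in> {0..1} \<Longrightarrow> norm (F n t) \<le> M n" "summable M"
    and "\<And>t. t \<in> {0..1} \<Longrightarrow> (\<lambda>n. F n t) sums f t"
  shows "(\<lambda>n. beta_mean a b (F n)) sums beta_mean a b f"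
  unfolding beta_mean_def by (rule sums_divide, rule beta_integral_sums[OF assms])

lemma sums_exp_complex: "(\<lambda>n. z ^ n / fact n) sums exp (z :: complex)"
  using exp_converges[of z] by (simp add: scaleR_conv_of_real field_simps)

text \<open>
  Euler's integral representation: the \<open>j\<close>-th moment is \<open>(a)\<^sub>j / (a+b)\<^sub>j\<close>.
\<close>
lemma kummer_1F1_eq_beta_mean:
  assumes ab: "Re a > 0" "Re b > 0"
  shows "kummer_1F1 a (a + b) z = beta_mean a b (\<lambda>t. exp (z * of_real t))"
proof -
  have "(\<lambda>j. beta_mean a b (\<lambda>t. (z * of_real t) ^ j / fact j)) sums beta_mean a b (\<lambda>t. exp (z * of_real t))"
  proof (rule beta_mean_sums[OF ab])
    show "norm ((z * of_real t) ^ j / fact j) \<le> norm z ^ j / fact j" if "t \<in> {0..1}" for j and t :: real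
      using that by (auto simp: norm_divide norm_power norm_mult power_mult_distrib
          intro!: divide_right_mono mult_left_le power_le_one)
    show "summable (\<lambda>j. norm z ^ j / fact j)"
      using summable_exp[of "norm z"] by (simp add: field_simps)
  qed (auto intro!: continuous_intros sums_exp_complex)
  moreover have "beta_mean a b (\<lambda>t. (z * of_real t) ^ j / fact j)
      = pochhammer a j / pochhammer (a + b) j * z ^ j / fact j" for j
    using beta_mean_cmult[of a b "z ^ j / fact j" "\<lambda>t. of_real t ^ j"] beta_mean_monomial[OF ab, of j 0]
    by (simp add: power_mult_distrib)
  ultimately show ?thesis
    unfolding kummer_1F1_def by (simp add: sums_iff)
qed

lemma linepath_complex: "linepath A B t = of_real (1 - t) * A + of_real t * B"
  by (simp add: linepath_def scaleR_conv_of_real)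

lemma norm_linepath_le:
  fixes A B :: complex
  assumes "t \<in> {0..1}"
  shows "norm (linepath A B t) \<le> max (norm A) (norm B)"
proof -
  have "norm (linepath A B t) \<le> (1 - t) * norm A + t * norm B"
    unfolding linepath_complex using norm_triangle_ineq[of "of_real (1 - t) * A" "of_real t * B"] assms
    by (simp only: norm_mult norm_of_real) auto
  also have "\<dots> \<le> (1 - t) * max (norm A) (norm B) + t * max (norm A) (norm B)"
    using assms by (intro add_mono mult_left_mono) auto
  finally show ?thesis by (simp add: algebra_simps)
qed

lemma Re_linepath_ge:
  assumes "t \<in> {0..1}"
  shows "Re (linepath A B t) \<ge> min (Re A) (Re B)"
proof -
  have "min (Re A) (Re B) = (1 - t) * min (Re A) (Re B) + t * min (Re A) (Re B)"
    by (simp add: algebra_simps)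
  also have "\<dots> \<le> (1 - t) * Re A + t * Re B"
    using assms by (intro add_mono mult_left_mono) auto
  finally show ?thesis by (simp add: linepath_complex)
qed

lemma Re_linepath_pos:
  assumes "Re A > 0" "Re B > 0" "t \<in> {0..1}"
  shows "Re (linepath A B t) > 0"
  using Re_linepath_ge[OF assms(3), of A B] assms(1,2) by linarith

lemma continuous_on_linepath_powr:
  assumes "Re A > 0" "Re B > 0"
  shows "continuous_on {0..1} (\<lambda>t. linepath A B t powr s)"
proof (rule continuous_on_powr_complex)
  show "{0..1} \<subseteq> {t. 0 \<le> Re (linepath A B t) \<or> Im (linepath A B t) \<noteq> 0}"
    using Re_linepath_pos[OF assms] by (auto intro: less_imp_le)
  show "Re s > 0" if "t \<in> {0..1}" "linepath A B t = 0" for t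
    using Re_linepath_pos[OF assms that(1)] that(2) by simp
qed (intro continuous_intros)+

text \<open>
  Expand \<open>((1-t) A + t B)\<^bsup>m\<^esup>\<close> by the binomial theorem and insert the moments. After division by
  \<open>m!\<close> and multiplication by \<open>(a+b)\<^sub>m\<close> the right-hand side is a Cauchy product coefficient.
\<close>
lemma beta_mean_linepath_power:
  assumes ab: "Re a > 0" "Re b > 0"
  shows "beta_mean a b (\<lambda>t. linepath A B t ^ m)
    = (\<Sum>i\<le>m. of_nat (m choose i) * (pochhammer a i * B ^ i) * (pochhammer b (m - i) * A ^ (m - i)))
        / pochhammer (a + b) m"
proof -
  have "beta_mean a b (\<lambda>t. linepath A B t ^ m)
     = beta_mean a b (\<lambda>t. \<Sum>i\<le>m. (of_nat (m choose i) * B ^ i * A ^ (m - i)) * (of_real t ^ i * of_real (1 - t) ^ (m - i)))"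
  proof (rule beta_mean_cong)
    fix t :: real
    have "linepath A B t = of_real t * B + of_real (1 - t) * A" by (simp add: linepath_complex)
    then show "linepath A B t ^ m = (\<Sum>i\<le>m. (of_nat (m choose i) * B ^ i * A ^ (m - i)) * (of_real t ^ i * of_real (1 - t) ^ (m - i)))"
      by (simp only: binomial_ring power_mult_distrib mult_ac)
  qed
  also have "\<dots> = (\<Sum>i\<le>m. (of_nat (m choose i) * B ^ i * A ^ (m - i)) * beta_mean a b (\<lambda>t. of_real t ^ i * of_real (1 - t) ^ (m - i)))"
    by (subst beta_mean_sum[OF ab]) (auto simp: beta_mean_cmult intro!: continuous_intros)
  also have "\<dots> = (\<Sum>i\<le>m. of_nat (m choose i) * (pochhammer a i * B ^ i) * (pochhammer b (m - i) * A ^ (m - i))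
        / pochhammer (a + b) m)"
    by (intro sum.cong refl) (simp only: beta_mean_monomial[OF ab], simp)
  finally show ?thesis by (simp add: sum_divide_distrib)
qed

lemma binomial_series_pochhammer:
  fixes w :: complex
  assumes "norm w < 1"
  shows "(\<lambda>n. pochhammer c n / fact n * w ^ n) sums (1 - w) powr (-c)"
    and "summable (\<lambda>n. norm (pochhammer c n / fact n * w ^ n))"
proof -
  have *: "(\<lambda>n. pochhammer c n / fact n * w ^ n) sums (1 - w) powr (-c)" if "norm w < 1" for w
  proof -
    have eq: "(-c gchoose n) * (- w) ^ n = pochhammer c n / fact n * w ^ n" for n
    proof -
      have "(-c gchoose n) * (- w) ^ n = ((-1) ^ n * (-1) ^ n) * (pochhammer c n / fact n * w ^ n)"
        by (subst power_minus) (simp add: gbinomial_pochhammer)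
      then show ?thesis by (simp flip: power_mult_distrib)
    qed
    show ?thesis using gen_binomial_complex[of "- w" "- c"] that by (simp add: eq)
  qed
  from *[OF assms] show "(\<lambda>n. pochhammer c n / fact n * w ^ n) sums (1 - w) powr (-c)" .
  define r where "r = (norm w + 1) / 2"
  have r: "norm w < r" "r < 1" "r > 0" using assms norm_ge_zero[of w] by (auto simp: r_def simp del: norm_ge_zero)
  then have "summable (\<lambda>n. pochhammer c n / fact n * complex_of_real r ^ n)"
    using *[of "of_real r"] sums_summable by force
  then show "summable (\<lambda>n. norm (pochhammer c n / fact n * w ^ n))"
    by (rule powser_insidea) (use r in auto)
qed

lemma powr_of_real_times:
  assumes "r > 0"
  shows "(of_real r * z) powr s = of_real r powr s * (z :: complex) powr s"
  using assms by (cases "z = 0") (auto simp: powr_def Ln_times_of_real Ln_of_real distrib_left exp_add)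

text \<open>
  The discs \<open>|z - R| < R\<close> exhaust the right half-plane as \<open>R\<close> grows:
  \<open>|A - R|\<^sup>2 < R\<^sup>2\<close> means \<open>|A|\<^sup>2 < 2 R Re A\<close>.
\<close>
lemma exists_disc_through_0_containing:
  assumes "Re A > 0"
  shows "\<exists>R0>0. \<forall>R\<ge>R0. norm (1 - A / of_real R) < 1"
proof -
  define R0 where "R0 = (norm A)\<^sup>2 / Re A"
  have A: "norm A > 0" using assms by auto
  have "norm (1 - A / of_real R) < 1" if "R \<ge> R0" for R
  proof -
    have "R0 > 0" using A assms by (simp add: R0_def)
    then have R: "R > 0" using that by simp
    have "(norm A)\<^sup>2 \<le> R * Re A" using that assms by (simp add: R0_def pos_divide_le_eq)
    moreover have "R * Re A > 0" using R assms by simp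
    ultimately have "(norm A)\<^sup>2 < 2 * (R * Re A)" by linarith
    then have "(R - Re A)\<^sup>2 + (Im A)\<^sup>2 < R\<^sup>2"
      unfolding cmod_power2 by (simp add: power2_eq_square algebra_simps)
    then have "(norm (of_real R - A))\<^sup>2 < R\<^sup>2" by (simp add: cmod_power2)
    then have "norm (of_real R - A) < R" using R power2_less_imp_less by fastforce
    moreover have "1 - A / of_real R = (of_real R - A) / of_real R" using R by (simp add: field_simps)
    ultimately show ?thesis using R by (simp add: norm_divide)
  qed
  moreover have "R0 > 0" using A assms by (simp add: R0_def)
  ultimately show ?thesis by blast
qed

text \<open>
  Feynman's parametrisation of \<open>A\<^bsup>-b\<^esup> B\<^bsup>-a\<^esup>\<close>. With \<open>A = R (1 - p)\<close>, \<open>B = R (1 - q)\<close> and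
  \<open>|p|, |q| < 1\<close>, the segment is \<open>R (1 - u(t))\<close> where \<open>u\<close> is the segment from \<open>p\<close> to \<open>q\<close>. The mean of the
  binomial series of \<open>(1 - u)\<^bsup>-(a+b)\<^esup>\<close> is the Cauchy product of those of \<open>(1 - q)\<^bsup>-a\<^esup>\<close> and
  \<open>(1 - p)\<^bsup>-b\<^esup>\<close>.
\<close>
lemma beta_mean_linepath_powr:
  assumes ab: "Re a > 0" "Re b > 0" and AB: "Re A > 0" "Re B > 0"
  shows "beta_mean a b (\<lambda>t. linepath A B t powr (- (a + b))) = A powr (- b) * B powr (- a)"
proof -
  obtain R where R: "R > 0" "norm (1 - A / of_real R) < 1" "norm (1 - B / of_real R) < 1"
    using exists_disc_through_0_containing[OF AB(1)] exists_disc_through_0_containing[OF AB(2)] by (metis less_le_trans max.cobounded1 max.cobounded2)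
  define p where "p = 1 - A / of_real R"
  define q where "q = 1 - B / of_real R"
  have pq: "norm p < 1" "norm q < 1" using R by (auto simp: p_def q_def)
  define \<mu> where "\<mu> = max (norm p) (norm q)"
  have \<mu>: "0 \<le> \<mu>" "\<mu> < 1" using pq by (auto simp: \<mu>_def le_max_iff_disj)
  let ?c = "\<lambda>n. pochhammer (a + b) n / fact n"
  have seg: "linepath A B t = of_real R * (1 - linepath p q t)" for t
    using R(1) by (simp add: linepath_complex p_def q_def field_simps)
  have A: "A powr s = of_real R powr s * (1 - p) powr s" for s
    using powr_of_real_times[OF R(1), of "1 - p" s] R(1) by (simp add: p_def)
  have B: "B powr s = of_real R powr s * (1 - q) powr s" for s
    using powr_of_real_times[OF R(1), of "1 - q" s] R(1) by (simp add: q_def)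
  have small: "norm (linepath p q t) \<le> \<mu>" if "t \<in> {0..1}" for t
    using norm_linepath_le[OF that] by (simp add: \<mu>_def)
  have "(\<lambda>m. beta_mean a b (\<lambda>t. ?c m * linepath p q t ^ m))
      sums beta_mean a b (\<lambda>t. (1 - linepath p q t) powr (- (a + b)))"
  proof (rule beta_mean_sums[OF ab])
    show "norm (?c m * linepath p q t ^ m) \<le> norm (?c m * of_real \<mu> ^ m)" if "t \<in> {0..1}" for m t
      unfolding norm_mult norm_power using small[OF that] \<mu> by (intro mult_left_mono power_mono) auto
    show "summable (\<lambda>m. norm (?c m * of_real \<mu> ^ m))"
      using \<mu> by (intro binomial_series_pochhammer) simp
    show "(\<lambda>m. ?c m * linepath p q t ^ m) sums (1 - linepath p q t) powr (- (a + b))"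
      if "t \<in> {0..1}" for t
      using small[OF that] \<mu> by (intro binomial_series_pochhammer) auto
  qed (intro continuous_intros)
  moreover have "beta_mean a b (\<lambda>t. ?c m * linepath p q t ^ m)
      = (\<Sum>i\<le>m. (pochhammer a i / fact i * q ^ i) * (pochhammer b (m - i) / fact (m - i) * p ^ (m - i)))" for m
  proof -
    have P: "pochhammer (a + b) m \<noteq> 0" using pochhammer_nonzero[of "a + b" m] ab by simp
    have "beta_mean a b (\<lambda>t. ?c m * linepath p q t ^ m)
       = (\<Sum>i\<le>m. of_nat (m choose i) * (pochhammer a i * q ^ i) * (pochhammer b (m - i) * p ^ (m - i))) / fact m"
      unfolding beta_mean_cmult beta_mean_linepath_power[OF ab] using P by simp
    also have "\<dots> = (\<Sum>i\<le>m. of_nat (m choose i) * (pochhammer a i * q ^ i) * (pochhammer b (m - i) * p ^ (m - i)) / fact m)"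
      by (rule sum_divide_distrib)
    also have "\<dots> = (\<Sum>i\<le>m. (pochhammer a i / fact i * q ^ i) * (pochhammer b (m - i) / fact (m - i) * p ^ (m - i)))"
      by (intro sum.cong refl) (simp add: binomial_fact)
    finally show ?thesis .
  qed
  ultimately have 1: "(\<lambda>m. \<Sum>i\<le>m. (pochhammer a i / fact i * q ^ i) * (pochhammer b (m - i) / fact (m - i) * p ^ (m - i)))
      sums beta_mean a b (\<lambda>t. (1 - linepath p q t) powr (- (a + b)))" by simp
  have 2: "(\<lambda>m. \<Sum>i\<le>m. (pochhammer a i / fact i * q ^ i) * (pochhammer b (m - i) / fact (m - i) * p ^ (m - i)))
      sums ((\<Sum>n. pochhammer a n / fact n * q ^ n) * (\<Sum>n. pochhammer b n / fact n * p ^ n))"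
    using Cauchy_product_sums[OF binomial_series_pochhammer(2)[OF pq(2)] binomial_series_pochhammer(2)[OF pq(1)]] .
  have "beta_mean a b (\<lambda>t. (1 - linepath p q t) powr (- (a + b))) = (1 - q) powr (- a) * (1 - p) powr (- b)"
    using sums_unique2[OF 1 2] binomial_series_pochhammer(1)[OF pq(1), THEN sums_unique]
      binomial_series_pochhammer(1)[OF pq(2), THEN sums_unique] by simp
  moreover have "beta_mean a b (\<lambda>t. linepath A B t powr (- (a + b)))
     = of_real R powr (- (a + b)) * beta_mean a b (\<lambda>t. (1 - linepath p q t) powr (- (a + b)))"
    by (simp only: seg powr_of_real_times[OF R(1)] beta_mean_cmult)
  moreover have "complex_of_real R powr (- (a + b)) = of_real R powr (- a) * of_real R powr (- b)"
    by (simp flip: powr_add)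
  ultimately show ?thesis
    by (simp add: A B mult_ac)
qed

text \<open>
  Feynman's formula for the parameters \<open>a + p\<close> and \<open>b + q\<close>, read as a statement about the mean for
  \<open>a\<close> and \<open>b\<close>.
\<close>
lemma beta_mean_linepath_powr_monomial:
  assumes ab: "Re a > 0" "Re b > 0" and AB: "Re A > 0" "Re B > 0"
  shows "beta_mean a b (\<lambda>t. of_real t ^ p * of_real (1 - t) ^ q * linepath A B t powr (- (a + b + of_nat (p + q))))
    = pochhammer a p * pochhammer b q / pochhammer (a + b) (p + q) * (A powr (- (b + of_nat q)) * B powr (- (a + of_nat p)))"
proof -
  let ?a = "a + of_nat p" and ?b = "b + of_nat q"
  have ab': "Re ?a > 0" "Re ?b > 0" using ab by auto
  have "beta_integral ?a ?b (\<lambda>t. linepath A B t powr (- (?a + ?b)))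
     = beta_moment ?a ?b * (A powr (- ?b) * B powr (- ?a))"
    using beta_mean_linepath_powr[OF ab' AB] beta_moment_nonzero[OF ab']
    by (simp add: beta_mean_def field_simps)
  moreover have "?a + ?b = a + b + of_nat (p + q)" by simp
  moreover have "beta_moment ?a ?b / beta_moment a b = pochhammer a p * pochhammer b q / pochhammer (a + b) (p + q)"
    using beta_mean_monomial[OF ab, of p q] beta_integral_shift[of a p b q "\<lambda>_. 1"]
    by (simp add: beta_mean_def)
  ultimately show ?thesis
    unfolding beta_mean_def beta_integral_shift[of a p b q, symmetric] by (metis times_divide_eq_left)
qed

text \<open>
  Writing \<open>1 = (t + (1 - t))\<^bsup>n\<^esup>\<close> raises the exponents of the weight by exactly the amount by which the
  exponent of \<open>z\<close> has dropped, so Feynman's formula applies to each term. The resulting sum is the mean of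
  an \<open>n\<close>-th power along the segment between the reciprocals.
\<close>
lemma beta_mean_linepath_powr_neg_power:
  assumes ab: "Re a > 0" "Re b > 0" and AB: "Re A > 0" "Re B > 0"
  shows "beta_mean a b (\<lambda>t. linepath A B t powr (- (a + b)) * inverse (linepath A B t) ^ n)
    = A powr (- b) * B powr (- a) * beta_mean b a (\<lambda>t. linepath (inverse B) (inverse A) t ^ n)"
proof -
  have nz: "A \<noteq> 0" "B \<noteq> 0" using AB by auto
  have shift: "z powr (- (c + of_nat i)) = z powr (- c) * inverse z ^ i" if "z \<noteq> 0" for z c :: complex and i
    using that by (simp add: powr_diff powr_nat field_simps)
  have segnz: "linepath A B t \<noteq> 0" if "t \<in> {0..1}" for t
    using Re_linepath_pos[OF AB that] by auto
  define G where "G i = (\<lambda>t. of_nat (n choose i) * (of_real t ^ i * of_real (1 - t) ^ (n - i)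
      * linepath A B t powr (- (a + b + of_nat n))))" for i
  have "beta_mean a b (\<lambda>t. linepath A B t powr (- (a + b)) * inverse (linepath A B t) ^ n)
      = beta_mean a b (\<lambda>t. \<Sum>i\<le>n. G i t)"
  proof (rule beta_mean_cong)
    fix t :: real assume t: "t \<in> {0..1}"
    have "(1::complex) = (of_real t + of_real (1 - t)) ^ n" by simp
    also have "\<dots> = (\<Sum>i\<le>n. of_nat (n choose i) * of_real t ^ i * of_real (1 - t) ^ (n - i))"
      by (rule binomial_ring)
    finally have one: "(\<Sum>i\<le>n. of_nat (n choose i) * of_real t ^ i * complex_of_real (1 - t) ^ (n - i)) = 1" by simp
    have "(\<Sum>i\<le>n. G i t) = (\<Sum>i\<le>n. of_nat (n choose i) * of_real t ^ i * complex_of_real (1 - t) ^ (n - i))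
        * linepath A B t powr (- (a + b + of_nat n))"
      unfolding G_def sum_distrib_right by (intro sum.cong refl) (simp only: mult.assoc)
    then show "linepath A B t powr (- (a + b)) * inverse (linepath A B t) ^ n = (\<Sum>i\<le>n. G i t)"
      unfolding one shift[OF segnz[OF t]] by simp
  qed
  also have "\<dots> = (\<Sum>i\<le>n. beta_mean a b (G i))"
  proof (rule beta_mean_sum[OF ab])
    show "continuous_on {0..1} (G i)" for i
      unfolding G_def by (intro continuous_intros continuous_on_linepath_powr AB)
  qed auto
  also have "\<dots> = (\<Sum>i\<le>n. of_nat (n choose i) * (pochhammer a i * pochhammer b (n - i) / pochhammer (a + b) n
      * (A powr (- b) * inverse A ^ (n - i) * (B powr (- a) * inverse B ^ i))))"
  proof (intro sum.cong refl)
    fix i assume "i \<in> {..n}"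
    then have n: "i + (n - i) = n" by simp
    show "beta_mean a b (G i) = of_nat (n choose i) * (pochhammer a i * pochhammer b (n - i) / pochhammer (a + b) n
      * (A powr (- b) * inverse A ^ (n - i) * (B powr (- a) * inverse B ^ i)))"
      unfolding G_def beta_mean_cmult
      using beta_mean_linepath_powr_monomial[OF ab AB, of i "n - i"] unfolding n shift[OF nz(1)] shift[OF nz(2)] by simp
  qed
  also have "\<dots> = (\<Sum>i\<le>n. A powr (- b) * B powr (- a) * (of_nat (n choose i) * (pochhammer b i * inverse A ^ i)
       * (pochhammer a (n - i) * inverse B ^ (n - i)) / pochhammer (b + a) n))"
    by (rule sum.reindex_bij_witness[of _ "\<lambda>i. n - i" "\<lambda>i. n - i"])
       (auto simp: binomial_symmetric[symmetric] add.commute)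
  also have "\<dots> = A powr (- b) * B powr (- a) * beta_mean b a (\<lambda>t. linepath (inverse B) (inverse A) t ^ n)"
    unfolding beta_mean_linepath_power[OF ab(2,1)] sum_distrib_left sum_divide_distrib ..
  finally show ?thesis .
qed

text \<open>
  The effect of \<open>z \<mapsto> 1/z\<close> on beta means of exponentials, which takes the arc \<open>1/z(t)\<close> to the straight
  segment from \<open>1/B\<close> to \<open>1/A\<close> and exchanges \<open>a\<close> and \<open>b\<close>. It follows from the previous lemma by summing the
  exponential series, which converges uniformly because \<open>1/z(t)\<close> is bounded.
\<close>
lemma beta_mean_linepath_powr_exp:
  assumes ab: "Re a > 0" "Re b > 0" and AB: "Re A > 0" "Re B > 0"
  shows "beta_mean a b (\<lambda>t. linepath A B t powr (- (a + b)) * exp (w / linepath A B t))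
    = A powr (- b) * B powr (- a) * beta_mean b a (\<lambda>t. exp (w * linepath (inverse B) (inverse A) t))"
proof -
  let ?z = "linepath A B" and ?u = "linepath (inverse B) (inverse A)"
  define \<delta> where "\<delta> = min (Re A) (Re B)"
  have \<delta>: "\<delta> > 0" using AB by (simp add: \<delta>_def)
  have Rez: "Re (?z t) \<ge> \<delta>" if "t \<in> {0..1}" for t
    using Re_linepath_ge[OF that] by (simp add: \<delta>_def)
  have znz: "?z t \<noteq> 0" if "t \<in> {0..1}" for t using Rez[OF that] \<delta> by auto
  have inv_le: "norm (inverse (?z t)) \<le> inverse \<delta>" if "t \<in> {0..1}" for t
    using Rez[OF that] \<delta> complex_Re_le_cmod[of "?z t"] by (auto simp: norm_inverse intro!: le_imp_inverse_le)
  have cont: "continuous_on {0..1} (\<lambda>t. ?z t powr (- (a + b)))"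
    by (rule continuous_on_linepath_powr[OF AB])
  then have "bounded ((\<lambda>t. ?z t powr (- (a + b))) ` {0..1})"
    by (intro compact_imp_bounded compact_continuous_image) auto
  then obtain C where C: "\<And>t. t \<in> {0..1} \<Longrightarrow> norm (?z t powr (- (a + b))) \<le> C"
    unfolding bounded_iff by (metis imageI)
  have "(\<lambda>n. beta_mean a b (\<lambda>t. w ^ n / fact n * (?z t powr (- (a + b)) * inverse (?z t) ^ n)))
      sums beta_mean a b (\<lambda>t. ?z t powr (- (a + b)) * exp (w / ?z t))"
  proof (rule beta_mean_sums[OF ab])
    show "continuous_on {0..1} (\<lambda>t. w ^ n / fact n * (?z t powr (- (a + b)) * inverse (?z t) ^ n))" for n
      using znz by (intro continuous_intros cont) auto
    show "norm (w ^ n / fact n * (?z t powr (- (a + b)) * inverse (?z t) ^ n)) \<le> norm w ^ n / fact n * (C * inverse \<delta> ^ n)"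
      if "t \<in> {0..1}" for n t
      unfolding norm_mult norm_divide norm_power using C[OF that] inv_le[OF that]
      by (intro mult_mono power_mono) (auto intro: order_trans[OF norm_ge_zero])
    show "summable (\<lambda>n. norm w ^ n / fact n * (C * inverse \<delta> ^ n))"
      using summable_mult[OF summable_exp[of "norm w * inverse \<delta>"], of C] by (simp add: field_simps power_mult_distrib)
    show "(\<lambda>n. w ^ n / fact n * (?z t powr (- (a + b)) * inverse (?z t) ^ n)) sums (?z t powr (- (a + b)) * exp (w / ?z t))"
      for t
      using sums_mult[OF sums_exp_complex[of "w / ?z t"], of "?z t powr (- (a + b))"]
      by (simp add: field_simps power_divide)
  qed
  moreover have "(\<lambda>n. beta_mean b a (\<lambda>t. w ^ n / fact n * ?u t ^ n)) sums beta_mean b a (\<lambda>t. exp (w * ?u t))"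
  proof (rule beta_mean_sums[OF ab(2,1)])
    show "continuous_on {0..1} (\<lambda>t. w ^ n / fact n * ?u t ^ n)" for n
      by (intro continuous_intros) auto
    show "norm (w ^ n / fact n * ?u t ^ n) \<le> norm w ^ n / fact n * max (norm (inverse B)) (norm (inverse A)) ^ n"
      if "t \<in> {0..1}" for n t
      unfolding norm_mult norm_divide norm_power using norm_linepath_le[OF that]
      by (intro mult_mono power_mono) auto
    show "summable (\<lambda>n. norm w ^ n / fact n * max (norm (inverse B)) (norm (inverse A)) ^ n)"
      using summable_exp[of "norm w * max (norm (inverse B)) (norm (inverse A))"]
      by (simp add: field_simps power_mult_distrib)
    show "(\<lambda>n. w ^ n / fact n * ?u t ^ n) sums exp (w * ?u t)" for t
      using sums_exp_complex[of "w * ?u t"] by (simp add: field_simps power_mult_distrib)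
  qed
  then have "(\<lambda>n. A powr (- b) * B powr (- a) * beta_mean b a (\<lambda>t. w ^ n / fact n * ?u t ^ n))
     sums (A powr (- b) * B powr (- a) * beta_mean b a (\<lambda>t. exp (w * ?u t)))"
    by (rule sums_mult)
  moreover have "A powr (- b) * B powr (- a) * beta_mean b a (\<lambda>t. w ^ n / fact n * ?u t ^ n)
      = beta_mean a b (\<lambda>t. w ^ n / fact n * (?z t powr (- (a + b)) * inverse (?z t) ^ n))" for n
    unfolding beta_mean_cmult beta_mean_linepath_powr_neg_power[OF ab AB] by (simp only: mult.left_commute)
  ultimately show ?thesis
    using sums_unique2 by simp
qed

section \<open>Inversion of the theta function and of its beta means\<close>

lemma theta_inversion_real:
  assumes "s > 0"
  shows "theta (1 / of_real s) = of_real s powr (1/2) * theta (of_real s)"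
proof -
  let ?\<epsilon> = "\<lambda>n::nat. if n = 0 then 1 else 2 :: real"
  have th: "theta (of_real u) = of_real S"
    if u: "u > 0" and S: "(\<lambda>n. ?\<epsilon> n * gaussian u (real n)) sums S" for u S
  proof -
    have "(\<lambda>n. complex_of_real (?\<epsilon> n * gaussian u (real n))) sums of_real S"
      using S by (rule sums_of_real)
    moreover have "complex_of_real (?\<epsilon> n * gaussian u (real n))
        = (if n = 0 then 1 else 2) * exp (- of_real pi * of_real u) ^ (n\<^sup>2)" for n
      by (simp add: gaussian_def mult_ac flip: exp_of_nat_mult exp_of_real)
    ultimately have "(\<lambda>n. (if n = 0 then 1 else 2) * exp (- of_real pi * of_real u) ^ (n\<^sup>2)) sums complex_of_real S"
      by simp
    then show ?thesis using theta_sums[of "of_real u"] u sums_unique2 by fastforce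
  qed
  obtain S where S: "(\<lambda>n. ?\<epsilon> n * gaussian s (real n)) sums S"
      "(\<lambda>n. ?\<epsilon> n * gaussian (1 / s) (real n)) sums (sqrt s * S)"
    using real_theta_inversion[OF assms] by blast
  have "theta (of_real (1 / s)) = of_real (sqrt s * S)" using th[OF _ S(2)] assms by simp
  moreover have "complex_of_real s powr (1/2) = of_real (sqrt s)"
    using powr_of_real[of s "1/2"] assms by (simp add: powr_half_sqrt)
  ultimately show ?thesis using th[OF assms S(1)] by simp
qed

lemma Re_inverse_pos: "Re z > 0 \<Longrightarrow> Re (inverse z) > 0"
  by (auto simp: complex_eq_iff sum_power2_gt_zero_iff intro!: divide_pos_pos)

text \<open>
  Both sides are holomorphic in the half-plane and agree on the positive reals, which accumulate at 1.
\<close>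
lemma theta_inversion:
  assumes "Re z > 0"
  shows "theta (inverse z) = z powr (1/2) * theta z"
proof -
  let ?H = "{z. Re z > 0}"
  have np: "z \<notin> \<real>\<^sub>\<le>\<^sub>0" if "Re z > 0" for z using that by (auto simp: complex_nonpos_Reals_iff)
  have "theta \<circ> inverse holomorphic_on ?H"
  proof (rule holomorphic_on_compose_gen[OF _ theta_holomorphic])
    show "inverse holomorphic_on ?H" by (intro holomorphic_intros) auto
  qed (auto intro: Re_inverse_pos)
  then have hol: "(\<lambda>z. theta (inverse z) - z powr (1/2) * theta z) holomorphic_on ?H"
    using np by (intro holomorphic_intros theta_holomorphic) (auto simp: o_def)
  have "(\<lambda>z. theta (inverse z) - z powr (1/2) * theta z) z = 0"
  proof (rule analytic_continuation[OF hol _ _ _ _ _ _ assms[folded mem_Collect_eq[of z "\<lambda>z. Re z > 0"]]])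
    show "open ?H" by (rule open_halfspace_Re_gt)
    show "connected ?H" by (rule convex_connected[OF convex_halfspace_Re_gt])
    show "complex_of_real ` {0<..} \<subseteq> ?H" by auto
    show "(1::complex) \<in> ?H" by simp
    show "1 islimpt complex_of_real ` {0<..}"
      unfolding islimpt_approachable
    proof (intro allI impI)
      fix e :: real assume "e > 0"
      then have "complex_of_real (1 + e / 2) \<in> complex_of_real ` {0<..}"
        and "complex_of_real (1 + e / 2) \<noteq> 1 \<and> dist (complex_of_real (1 + e / 2)) 1 < e"
        by (simp del: of_real_add, simp add: dist_norm)
      then show "\<exists>w\<in>complex_of_real ` {0<..}. w \<noteq> 1 \<and> dist w 1 < e" by blast
    qed
    show "theta (inverse w) - w powr (1/2) * theta w = 0" if "w \<in> complex_of_real ` {0<..}" for w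
      using that theta_inversion_real by (auto simp: inverse_eq_divide)
  qed
  then show ?thesis by simp
qed

text \<open>
  The arguments of \<open>A\<close> and \<open>B\<close> lie in \<open>(-\<pi>/2, \<pi>/2)\<close>, so principal logarithms add without a correction.
\<close>
lemma Re_pos_powr_mult:
  assumes "Re A > 0" "Re B > 0"
  shows "(A * B) powr s = A powr s * B powr s" "(B / A) powr s = B powr s * A powr (- s)"
proof -
  have nz: "A \<noteq> 0" "B \<noteq> 0" using assms by auto
  have im: "\<bar>Im (Ln A)\<bar> < pi / 2" "\<bar>Im (Ln B)\<bar> < pi / 2"
    using Re_Ln_pos_lt nz assms by blast+
  have *: "Ln (A * B) = Ln A + Ln B" by (rule Ln_times_simple) (use nz im in auto)
  have inv: "Ln (inverse A) = - Ln A" by (rule Ln_inverse) (use assms in \<open>auto simp: complex_nonpos_Reals_iff\<close>)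
  have **: "Ln (B * inverse A) = Ln B - Ln A" 
    by (subst Ln_times_simple) (use nz im inv in auto)
  show "(A * B) powr s = A powr s * B powr s"
    using nz by (simp add: powr_def * distrib_left exp_add)
  show "(B / A) powr s = B powr s * A powr (- s)"
    using nz by (simp add: powr_def divide_inverse ** right_diff_distrib exp_diff exp_minus)
qed

lemma norm_exp_neg_nat_le:
  assumes "d \<le> Re z"
  shows "norm (exp (- of_real pi * of_nat n * z)) \<le> norm (exp (- of_real pi * of_nat n * complex_of_real d))"
  using assms by (simp add: mult_left_mono)

text \<open>
  On a path in a half-plane \<open>Re z \<ge> d > 0\<close> the theta series is dominated by its value at \<open>d\<close>.
\<close>
lemma beta_mean_theta_power_sums:
  assumes ab: "Re a > 0" "Re b > 0" and d: "d > 0"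
    and z: "continuous_on {0..1} z" "\<And>t. t \<in> {0..1} \<Longrightarrow> d \<le> Re (z t)"
    and h: "continuous_on {0..1} h"
  shows "(\<lambda>n. of_nat (num_sum_squares k n) * beta_mean a b (\<lambda>t. h t * exp (- of_real pi * of_nat n * z t)))
     sums beta_mean a b (\<lambda>t. h t * theta (z t) ^ k)"
proof -
  have "bounded (h ` {0..1})"
    using h by (intro compact_imp_bounded compact_continuous_image) auto
  then obtain C where C: "\<And>t. t \<in> {0..1} \<Longrightarrow> norm (h t) \<le> C"
    unfolding bounded_iff by (metis imageI)
  let ?r = "\<lambda>n. of_nat (num_sum_squares k n) :: complex"
  have "(\<lambda>n. beta_mean a b (\<lambda>t. ?r n * (h t * exp (- of_real pi * of_nat n * z t))))
     sums beta_mean a b (\<lambda>t. h t * theta (z t) ^ k)"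
  proof (rule beta_mean_sums[OF ab])
    show "continuous_on {0..1} (\<lambda>t. ?r n * (h t * exp (- of_real pi * of_nat n * z t)))" for n
      by (intro continuous_intros h z)
    show "norm (?r n * (h t * exp (- of_real pi * of_nat n * z t)))
        \<le> C * norm (?r n * exp (- of_real pi * of_nat n * complex_of_real d))" if t: "t \<in> {0..1}" for n t
    proof -
      have "norm (h t) * norm (exp (- of_real pi * of_nat n * z t))
          \<le> C * norm (exp (- of_real pi * of_nat n * complex_of_real d))"
        by (rule mult_mono[OF C[OF t] norm_exp_neg_nat_le[OF z(2)[OF t]]])
           (use order_trans[OF norm_ge_zero C[OF t]] in auto)
      from mult_left_mono[OF this norm_ge_zero[of "?r n"]] show ?thesis
        by (simp only: norm_mult mult_ac)
    qed
    show "summable (\<lambda>n. C * norm (?r n * exp (- of_real pi * of_nat n * complex_of_real d)))"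
      by (intro summable_mult theta_power_sums) (use d in simp)
    show "(\<lambda>n. ?r n * (h t * exp (- of_real pi * of_nat n * z t))) sums (h t * theta (z t) ^ k)"
      if "t \<in> {0..1}" for t
      using sums_mult[OF theta_power_sums(1)[of "z t" k], of "h t"] z(2)[OF that] d
      by (simp add: mult_ac)
  qed
  then show ?thesis unfolding beta_mean_cmult .
qed

text \<open>
  The mean of \<open>\<theta>\<^bsup>k\<^esup>\<close> along the segment from \<open>A\<close> to \<open>B\<close>, expanded in two ways: directly, and after
  rewriting \<open>\<theta>(z)\<^bsup>k\<^esup>\<close> as \<open>z\<^bsup>-k/2\<^esup> \<theta>(1/z)\<^bsup>k\<^esup>\<close>. The condition \<open>a + b = k/2\<close> is exactly what makes the
  power of \<open>z\<close> fit the Feynman formula.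
\<close>
lemma beta_mean_theta_inversion:
  assumes ab: "Re a > 0" "Re b > 0" "a + b = of_nat k / 2" and AB: "Re A > 0" "Re B > 0"
  defines "r \<equiv> \<lambda>n. of_nat (num_sum_squares k n) :: complex"
  shows "\<exists>T. (\<lambda>n. r n * beta_mean a b (\<lambda>t. exp (- of_real pi * of_nat n * linepath A B t))) sums T \<and>
    (\<lambda>n. A powr (- b) * B powr (- a) * (r n * beta_mean b a (\<lambda>t. exp (- of_real pi * of_nat n * linepath (inverse B) (inverse A) t)))) sums T"
proof -
  let ?z = "linepath A B"
  define d where "d = min (Re A) (Re B)"
  define m where "m = max (norm A) (norm B)"
  have d: "d > 0" using AB by (simp add: d_def)
  have m: "m > 0" using AB by (auto simp: m_def less_max_iff_disj)
  have z: "d \<le> Re (?z t)" "norm (?z t) \<le> m" if "t \<in> {0..1}" for t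
    using Re_linepath_ge[OF that] norm_linepath_le[OF that] by (auto simp: d_def m_def)
  have znz: "?z t \<noteq> 0" if "t \<in> {0..1}" for t using z(1)[OF that] d by auto
  \<comment> \<open>\<open>Re (1/z) = Re z / |z|\<^sup>2\<close>, so the reciprocal path also stays in a half-plane \<open>Re \<ge> const > 0\<close>.\<close>
  have zinv: "d / m\<^sup>2 \<le> Re (inverse (?z t))" if t: "t \<in> {0..1}" for t
  proof -
    have "d / m\<^sup>2 \<le> Re (?z t) / (norm (?z t))\<^sup>2"
      using z[OF t] d znz[OF t] by (intro frac_le power_mono) auto
    then show ?thesis by (simp add: cmod_power2)
  qed
  have "(\<lambda>n. r n * beta_mean a b (\<lambda>t. 1 * exp (- of_real pi * of_nat n * ?z t)))
     sums beta_mean a b (\<lambda>t. 1 * theta (?z t) ^ k)"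
    unfolding r_def by (rule beta_mean_theta_power_sums[OF ab(1,2) d]) (auto intro!: continuous_intros z)
  moreover have "(\<lambda>n. r n * beta_mean a b (\<lambda>t. ?z t powr (- (a + b)) * exp (- of_real pi * of_nat n * inverse (?z t))))
     sums beta_mean a b (\<lambda>t. ?z t powr (- (a + b)) * theta (inverse (?z t)) ^ k)"
    unfolding r_def
  proof (rule beta_mean_theta_power_sums[OF ab(1,2) _ _ zinv])
    show "d / m\<^sup>2 > 0" using d m by simp
    show "continuous_on {0..1} (\<lambda>t. inverse (?z t))"
      by (intro continuous_intros) (use znz in auto)
    show "continuous_on {0..1} (\<lambda>t. ?z t powr (- (a + b)))"
      by (rule continuous_on_linepath_powr[OF AB])
  qed
  moreover have "beta_mean a b (\<lambda>t. ?z t powr (- (a + b)) * theta (inverse (?z t)) ^ k)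
     = beta_mean a b (\<lambda>t. 1 * theta (?z t) ^ k)"
  proof (rule beta_mean_cong)
    fix t :: real assume t: "t \<in> {0..1}"
    have "Re (?z t) > 0" using z(1)[OF t] d by linarith
    then have "theta (inverse (?z t)) ^ k = (?z t powr (1/2)) ^ k * theta (?z t) ^ k"
      by (simp add: theta_inversion power_mult_distrib)
    also have "(?z t powr (1/2)) ^ k = ?z t powr (a + b)"
      unfolding ab(3) powr_def using znz[OF t] by (simp flip: exp_of_nat_mult)
    finally have "?z t powr (- (a + b)) * theta (inverse (?z t)) ^ k
        = (?z t powr (- (a + b)) * ?z t powr (a + b)) * theta (?z t) ^ k"
      by (simp only: mult.assoc)
    also have "?z t powr (- (a + b)) * ?z t powr (a + b) = 1"
      unfolding powr_add[symmetric] using znz[OF t] by simp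
    finally show "?z t powr (- (a + b)) * theta (inverse (?z t)) ^ k = 1 * theta (?z t) ^ k" .
  qed
  moreover have "beta_mean a b (\<lambda>t. ?z t powr (- (a + b)) * exp (- of_real pi * of_nat n * inverse (?z t)))
     = A powr (- b) * B powr (- a) * beta_mean b a (\<lambda>t. exp (- of_real pi * of_nat n * linepath (inverse B) (inverse A) t))" for n
    using beta_mean_linepath_powr_exp[OF ab(1,2) AB, of "- of_real pi * of_nat n"] by (simp only: divide_inverse)
  ultimately show ?thesis by (auto simp: mult.left_commute)
qed

section \<open>The summation formula\<close>

theorem theorem1p1:
  fixes k :: nat and x y \<rho> :: complex
  assumes "k \<ge> 1"
    and "Re x > \<bar>Re y\<bar>"
    and "- (real k / 4) < Re \<rho>" and "Re \<rho> < real k / 4"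
  defines "\<nu> \<equiv> (of_nat k / 4 - 1/2 :: complex)"
    and "r \<equiv> (\<lambda>n. of_nat (num_sum_squares k n) :: complex)"
  defines "f \<equiv> (\<lambda>n::nat. r n / of_nat n powr (of_nat k / 4)
                 * exp (- of_real pi * of_nat n * x)
                 * whittaker_M \<rho> \<nu> (2 * of_real pi * of_nat n * y))"
    and "g \<equiv> (\<lambda>n::nat. r n / of_nat n powr (of_nat k / 4)
                 * exp (- (of_real pi * of_nat n * x / (x\<^sup>2 - y\<^sup>2)))
                 * whittaker_M_quot (- \<rho>) \<nu> (2 * pi * real n) y (x\<^sup>2 - y\<^sup>2))"
  shows "summable (\<lambda>n. f (Suc n)) \<and> summable (\<lambda>n. g (Suc n)) \<and>
         (2 * of_real pi * y) powr (of_nat k / 4) + (\<Sum>n. f (Suc n)) =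
           quot_powr (2 * pi) y (x\<^sup>2 - y\<^sup>2) (of_nat k / 4) * ((x - y) / (x + y)) powr \<rho>
           + ((x - y) / (x + y)) powr \<rho> * (\<Sum>n. g (Suc n))"
proof -
  define \<kappa> where "\<kappa> = (of_nat k / 4 :: complex)"
  define a where "a = \<kappa> - \<rho>"
  define b where "b = \<kappa> + \<rho>"
  define A where "A = x + y"
  define B where "B = x - y"
  have ab: "Re a > 0" "Re b > 0" "a + b = of_nat k / 2"
    using assms(3,4) by (auto simp: a_def b_def \<kappa>_def)
  have AB: "Re A > 0" "Re B > 0" using assms(2) by (auto simp: A_def B_def)
  then have nz: "A \<noteq> 0" "B \<noteq> 0" by auto
  have D: "x\<^sup>2 - y\<^sup>2 = A * B" by (simp add: A_def B_def power2_eq_square algebra_simps)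
  define P where "P = (2 * of_real pi * y) powr \<kappa>"
  define Q where "Q = quot_powr (2 * pi) y (A * B) \<kappa>"
  define R where "R = (B / A) powr \<rho>"
  define W where "W = A powr (- b) * B powr (- a)"
  define E where "E n = r n * beta_mean a b (\<lambda>t. exp (- of_real pi * of_nat n * linepath A B t))" for n
  define G where "G n = r n * beta_mean b a (\<lambda>t. exp (- of_real pi * of_nat n * linepath (inverse B) (inverse A) t))" for n
  have W0: "W \<noteq> 0" using nz by (simp add: W_def)

  \<comment> \<open>The factors in front of the two sides agree, branches included.\<close>
  have PW: "P * W = R * Q"
  proof -
    have "P = of_real (2 * pi) powr \<kappa> * y powr \<kappa>"
      unfolding P_def using powr_of_real_times[of "2 * pi" y \<kappa>] by simp
    moreover have "W = (A powr (- \<kappa>) * B powr (- \<kappa>)) * (B powr \<rho> * A powr (- \<rho>))"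
      unfolding W_def a_def b_def minus_add_distrib minus_diff_eq
      using nz by (simp add: powr_add powr_diff powr_minus field_simps)
    ultimately show ?thesis
      unfolding R_def Q_def quot_powr_def Re_pos_powr_mult[OF AB] by (simp only: mult_ac)
  qed

  have exp_arg: "2 * \<nu> + 1 = a + b" "\<nu> - \<rho> + 1/2 = a" "\<nu> - (- \<rho>) + 1/2 = b" "\<nu> + 1/2 = \<kappa>"
    by (simp_all add: \<nu>_def a_def b_def \<kappa>_def)

  have f: "f n = P * E n" if n: "n > 0" for n
  proof -
    let ?w = "2 * of_real pi * of_nat n * y"
    have "?w powr \<kappa> = of_nat n powr \<kappa> * P"
      using powr_of_real_times[of "real n" "2 * of_real pi * y" \<kappa>] n by (simp add: P_def mult_ac)
    then have "f n = P * (r n * (exp (- of_real pi * of_nat n * x) * exp (- ?w / 2) * kummer_1F1 a (a + b) ?w))"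
      using n unfolding f_def whittaker_M_def whittaker_M_branch_def exp_arg \<kappa>_def[symmetric] by simp
    also have "exp (- of_real pi * of_nat n * x) * exp (- ?w / 2) * kummer_1F1 a (a + b) ?w
        = beta_mean a b (\<lambda>t. exp (- of_real pi * of_nat n * linepath A B t))"
      unfolding kummer_1F1_eq_beta_mean[OF ab(1,2)] beta_mean_cmult[symmetric]
      by (simp add: linepath_complex A_def B_def algebra_simps flip: exp_add)
    finally show ?thesis by (simp add: E_def)
  qed

  have g: "g n = Q * G n" if n: "n > 0" for n
  proof -
    let ?w = "of_real (2 * pi * real n) * y / (A * B)"
    have inv: "x / (A * B) + y / (A * B) = inverse B" "2 * y / (A * B) = inverse B - inverse A"
      using nz by (simp_all add: field_simps) (simp_all add: A_def B_def algebra_simps)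
    have "quot_powr (2 * pi * real n) y (A * B) \<kappa> = of_nat n powr \<kappa> * Q"
      using powr_of_real_times[of "real n" "of_real (2 * pi)" \<kappa>] n
      by (simp add: Q_def quot_powr_def mult_ac)
    then have "g n = Q * (r n * (exp (- (of_real pi * of_nat n * x / (A * B))) * exp (- ?w / 2) * kummer_1F1 b (b + a) ?w))"
      using n unfolding g_def D whittaker_M_quot_def whittaker_M_branch_def exp_arg \<kappa>_def[symmetric]
      by (simp add: add.commute[of a])
    also have "exp (- (of_real pi * of_nat n * x / (A * B))) * exp (- ?w / 2)
        = exp (- of_real pi * of_nat n * inverse B)"
      unfolding inv(1)[symmetric] by (simp add: field_simps flip: exp_add)
    also have "exp (- of_real pi * of_nat n * inverse B) * kummer_1F1 b (b + a) ?w
        = beta_mean b a (\<lambda>t. exp (- of_real pi * of_nat n * linepath (inverse B) (inverse A) t))"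
    proof -
      have w: "?w = of_real pi * of_nat n * (inverse B - inverse A)"
        unfolding inv(2)[symmetric] by simp
      show ?thesis
        unfolding kummer_1F1_eq_beta_mean[OF ab(2,1)] beta_mean_cmult[symmetric] w
        by (simp add: linepath_complex algebra_simps flip: exp_add)
    qed
    finally show ?thesis by (simp add: G_def)
  qed

  have one: "beta_mean a' b' (\<lambda>_. 1) = 1" if "Re a' > 0" "Re b' > 0" for a' b'
    using beta_moment_nonzero[OF that] by (simp add: beta_mean_def)
  have "r 0 = 1"
    unfolding r_def fps_nth_theta_power[symmetric] fps_power_zeroth
    by (simp add: theta_fps_def square_roots_square[of 0, simplified])
  then have EG0: "E 0 = 1" "G 0 = 1" using one ab(1,2) by (simp_all add: E_def G_def)

  obtain T where T: "E sums T" "(\<lambda>n. W * G n) sums T"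
    using beta_mean_theta_inversion[OF ab AB] unfolding E_def G_def W_def r_def by blast
  have G: "G sums (T / W)" using sums_divide[OF T(2), of W] W0 by simp
  have "(\<lambda>n. f (Suc n)) sums (P * (T - 1))"
    using T(1) EG0(1) f by (simp add: sums_Suc_iff sums_mult)
  moreover have "(\<lambda>n. g (Suc n)) sums (Q * (T / W - 1))"
    using G EG0(2) g by (simp add: sums_Suc_iff sums_mult)
  moreover have "P + P * (T - 1) = Q * R + R * (Q * (T / W - 1))"
  proof -
    have "Q * R + R * (Q * (T / W - 1)) = (R * Q) * (T / W)" by (simp add: algebra_simps)
    also have "\<dots> = P * T" unfolding PW[symmetric] using W0 by simp
    finally show ?thesis by (simp add: algebra_simps)
  qed
  ultimately show ?thesis
    unfolding D by (simp add: sums_iff P_def Q_def R_def \<kappa>_def A_def[symmetric] B_def[symmetric])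
qed

end
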